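(* Let $(\mathbf{H},\mathbf{s})$ be a No instance of $\mathrm{SD}(n,k,w)$, and let $G^{\mathrm{rel}}_{\mathrm{Stern}}$ be the associated two-player game with parameter $Q$ described in the context. Then its entangled value satisfies $$\omega^*(G^{\mathrm{rel}}_{\mathrm{Stern}})\le \frac{2}{3}+\left(\frac{n!\,2^{4n}}{Q}\right)^{1/4}.$$
   Context: Syndrome Decoding $\mathrm{SD}(n,k,w)$: an instance is a matrix $\mathbf{H}\in\{0,1\}^{(n-k)\times n}$ and a column vector $\mathbf{s}\in\{0,1\}^{n-k}$; linear algebra on binary vectors is over $\mathbb{F}_2$ ($\oplus$ is addition mod 2), and $|\cdot|_H$ is the Hamming weight. $(\mathbf{H},\mathbf{s})$ is a No instance if there is no $\mathbf{e}\in\{0,1\}^n$ with $\mathbf{H}\mathbf{e}=\mathbf{s}$ and $|\mathbf{e}|_H=w$. $\mathbb{F}_Q=\{\overline{0},\dots,\overline{Q-1}\}$ is the finite field with $Q$ elements (enumerated in some fixed order). $P_n$ is the set of permutations of $[n]$, acting on $\{0,1\}^n$ by permuting coordinates. Let $S_1=P_n\times\{0,1\}^{n-k}$; assume $Q\ge|S_1|$ and $Q\ge 2^n$. Fix enumerations of $S_1$ and $\{0,1\}^n$. An element $z_1=\overline{j}\in\mathbb{F}_Q$ with $j<|S_1|$ is mapped to the $j$-th element $(\sigma,\mathbf{s}')$ of $S_1$; for $i\in\{2,3\}$, an element $z_i=\overline{j}$ with $j<2^n$ is mapped to the $j$-th vector of $\{0,1\}^n$; for all other elements the mapping fails. Game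 $G^{\mathrm{rel}}_{\mathrm{Stern}}$: Alice receives $B=(b_1,b_2,b_3)$ uniform in $\mathbb{F}_Q^3$; Bob receives independently $c$ uniform in $\{1,2,3\}$. Alice outputs $Y=(y_1,y_2,y_3)\in\mathbb{F}_Q^3$ and Bob outputs $AZ=\{(a_{c'},z_{c'})\}_{c'\in\{1,2,3\}\setminus\{c\}}$ with all $a_{c'},z_{c'}\in\mathbb{F}_Q$. They win iff the mapping succeeds for each $z_{c'}$ output by Bob, $y_{c'}=a_{c'}+z_{c'}*b_{c'}$ in $\mathbb{F}_Q$ for both $c'\ne c$, and (using the mapped values): - if $c=1$: $|z_2\oplus z_3|_H=w$; - if $c=2$: $\mathbf{H}\sigma^{-1}(z_3)=\mathbf{s}\oplus\mathbf{s}'$, where $z_1=(\sigma,\mathbf{s}')$; - if $c=3$: $\mathbf{H}\sigma^{-1}(z_2)=\mathbf{s}'$, where $z_1=(\sigma,\mathbf{s}')$. The entangled value $\omega^*(G)$ is the supremum of the winning probability over all strategies in which Alice and Bob share a finite-dimensional bipartite quantum state, do not communicate, and each produces the output by a measurement on their own share depending on their own input. *)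

theory Defs
  imports
    "HOL-Library.Z2"
    "HOL-Library.FuncSet"
    "HOL-Library.Cardinality"
    "HOL-Combinatorics.Permutations"
    "Jordan_Normal_Form.Matrix"
begin

section \<open>Finite-dimensional quantum states and measurements\<close>

text \<open>Over the complex numbers the order is the one of \<^theory>\<open>HOL-Library.Complex_Order\<close>: the
  inequality below says that the quadratic form is real and nonnegative, which also makes the
  matrix Hermitian.\<close>

definition psd_mat :: "nat \<Rightarrow> complex mat \<Rightarrow> bool" where
  "psd_mat d M \<longleftrightarrow> M \<in> carrier_mat d d \<and> (\<forall>v \<in> carrier_vec d. 0 \<le> (M *\<^sub>v v) \<bullet>c v)"

definition mat_trace :: "complex mat \<Rightarrow> complex" where
  "mat_trace M = (\<Sum>i<dim_row M. M $$ (i, i))"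

definition density_mat :: "nat \<Rightarrow> complex mat \<Rightarrow> bool" where
  "density_mat d \<rho> \<longleftrightarrow> psd_mat d \<rho> \<and> mat_trace \<rho> = 1"

definition povm :: "nat \<Rightarrow> 'a set \<Rightarrow> ('a \<Rightarrow> complex mat) \<Rightarrow> bool" where
  "povm d S M \<longleftrightarrow> (\<forall>a\<in>S. psd_mat d (M a)) \<and> mat d d (\<lambda>ij. \<Sum>a\<in>S. M a $$ ij) = 1\<^sub>m d"

text \<open>Kronecker product; the basis vector $e_i \otimes e_j$ has index
  \<open>i * dim + j\<close>, where \<open>dim\<close> is the dimension of the second factor.\<close>

definition kron :: "complex mat \<Rightarrow> complex mat \<Rightarrow> complex mat" where
  "kron A B = mat (dim_row A * dim_row B) (dim_col A * dim_col B)
     (\<lambda>(i, j). A $$ (i div dim_row B, j div dim_col B) * B $$ (i mod dim_row B, j mod dim_col B))"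


section \<open>Two-player games and their entangled value\<close>

text \<open>The two questions are independent and uniform on \<open>quA\<close> and \<open>quB\<close>. The set of possible
  answers of a player may depend on the question that this player receives.\<close>

record ('x, 'y, 'a, 'b) game =
  quA :: "'x set"
  quB :: "'y set"
  ansA :: "'x \<Rightarrow> 'a set"
  ansB :: "'y \<Rightarrow> 'b set"
  wins :: "'x \<Rightarrow> 'y \<Rightarrow> 'a \<Rightarrow> 'b \<Rightarrow> bool"

definition quantum_strategy ::
  "('x, 'y, 'a, 'b) game \<Rightarrow> nat \<Rightarrow> nat \<Rightarrow> complex mat \<Rightarrow>
     ('x \<Rightarrow> 'a \<Rightarrow> complex mat) \<Rightarrow> ('y \<Rightarrow> 'b \<Rightarrow> complex mat) \<Rightarrow> bool" where
  "quantum_strategy G dA dB \<rho> A B \<longleftrightarrow>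
     density_mat (dA * dB) \<rho> \<and>
     (\<forall>x \<in> quA G. povm dA (ansA G x) (A x)) \<and>
     (\<forall>y \<in> quB G. povm dB (ansB G y) (B y))"

definition win_prob ::
  "('x, 'y, 'a, 'b) game \<Rightarrow> complex mat \<Rightarrow>
     ('x \<Rightarrow> 'a \<Rightarrow> complex mat) \<Rightarrow> ('y \<Rightarrow> 'b \<Rightarrow> complex mat) \<Rightarrow> real" where
  "win_prob G \<rho> A B =
     (\<Sum>x \<in> quA G. \<Sum>y \<in> quB G. \<Sum>a \<in> ansA G x. \<Sum>b \<in> ansB G y.
        if wins G x y a b then Re (mat_trace (\<rho> * kron (A x a) (B y b))) else 0)
     / (real (card (quA G)) * real (card (quB G)))"

text \<open>For finite nonempty question sets and finite nonempty answer sets the set below is a nonempty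
  set of probabilities, so the real supremum is the genuine one.\<close>

definition entangled_value :: "('x, 'y, 'a, 'b) game \<Rightarrow> real" where
  "entangled_value G =
     Sup {win_prob G \<rho> A B | dA dB \<rho> A B. quantum_strategy G dA dB \<rho> A B}"


section \<open>Syndrome decoding\<close>

definition hamming_weight :: "bit vec \<Rightarrow> nat" where
  "hamming_weight v = card {i. i < dim_vec v \<and> v $ i \<noteq> 0}"

definition sd_instance :: "nat \<Rightarrow> nat \<Rightarrow> bit mat \<Rightarrow> bit vec \<Rightarrow> bool" where
  "sd_instance n k H s \<longleftrightarrow> H \<in> carrier_mat (n - k) n \<and> s \<in> carrier_vec (n - k)"

definition sd_no_instance :: "nat \<Rightarrow> nat \<Rightarrow> nat \<Rightarrow> bit mat \<Rightarrow> bit vec \<Rightarrow> bool" where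
  "sd_no_instance n k w H s \<longleftrightarrow>
     sd_instance n k H s \<and> \<not> (\<exists>e \<in> carrier_vec n. H *\<^sub>v e = s \<and> hamming_weight e = w)"


section \<open>The relativistic Stern game\<close>

text \<open>Coordinates are numbered from 0, and a permutation \<open>\<sigma>\<close> moves the entry at position \<open>i\<close> to
  position \<open>\<sigma> i\<close>.\<close>

definition permute_vec :: "(nat \<Rightarrow> nat) \<Rightarrow> 'a vec \<Rightarrow> 'a vec" where
  "permute_vec \<sigma> v = vec (dim_vec v) (\<lambda>i. v $ (inv_into UNIV \<sigma> i))"

definition S1 :: "nat \<Rightarrow> nat \<Rightarrow> ((nat \<Rightarrow> nat) \<times> bit vec) set" where
  "S1 n k = {\<sigma>. \<sigma> permutes {..<n}} \<times> carrier_vec (n - k)"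

text \<open>\<open>fe\<close> enumerates the field from index 0 on, and \<open>e\<close> enumerates a set with \<open>N\<close> elements; the
  result is \<open>None\<close> where the mapping fails.\<close>

definition decode :: "(nat \<Rightarrow> 'f::finite) \<Rightarrow> nat \<Rightarrow> (nat \<Rightarrow> 'c) \<Rightarrow> 'f \<Rightarrow> 'c option" where
  "decode fe N e z =
     (let j = the_inv_into {..<CARD('f)} fe z in if j < N then Some (e j) else None)"

text \<open>Alice's questions and answers are triples indexed by \<open>{1,2,3}\<close>. Bob's answer to the question
  \<open>c\<close> is a family of pairs $(a_i, z_i)$ indexed by \<open>{1,2,3} - {c}\<close>.\<close>

definition stern_wins ::
  "nat \<Rightarrow> nat \<Rightarrow> nat \<Rightarrow> bit mat \<Rightarrow> bit vec \<Rightarrow>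
     (nat \<Rightarrow> 'f::{field,finite}) \<Rightarrow> (nat \<Rightarrow> (nat \<Rightarrow> nat) \<times> bit vec) \<Rightarrow> (nat \<Rightarrow> bit vec) \<Rightarrow>
     (nat \<Rightarrow> 'f) \<Rightarrow> nat \<Rightarrow> (nat \<Rightarrow> 'f) \<Rightarrow> (nat \<Rightarrow> 'f \<times> 'f) \<Rightarrow> bool" where
  "stern_wins n k w H s fe e1 e2 b c y az \<longleftrightarrow>
     (let z1 = decode fe (card (S1 n k)) e1 (snd (az 1));
          z2 = decode fe (2 ^ n) e2 (snd (az 2));
          z3 = decode fe (2 ^ n) e2 (snd (az 3))
      in (\<forall>i \<in> {1,2,3} - {c}. y i = fst (az i) + snd (az i) * b i) \<and>
         (c = 1 \<longrightarrow> (\<exists>v2 v3. z2 = Some v2 \<and> z3 = Some v3 \<and> hamming_weight (v2 + v3) = w)) \<and>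
         (c = 2 \<longrightarrow> (\<exists>\<sigma> s' v3. z1 = Some (\<sigma>, s') \<and> z3 = Some v3 \<and>
                        H *\<^sub>v permute_vec (inv_into UNIV \<sigma>) v3 = s + s')) \<and>
         (c = 3 \<longrightarrow> (\<exists>\<sigma> s' v2. z1 = Some (\<sigma>, s') \<and> z2 = Some v2 \<and>
                        H *\<^sub>v permute_vec (inv_into UNIV \<sigma>) v2 = s')))"

definition stern_game ::
  "nat \<Rightarrow> nat \<Rightarrow> nat \<Rightarrow> bit mat \<Rightarrow> bit vec \<Rightarrow>
     (nat \<Rightarrow> 'f::{field,finite}) \<Rightarrow> (nat \<Rightarrow> (nat \<Rightarrow> nat) \<times> bit vec) \<Rightarrow> (nat \<Rightarrow> bit vec) \<Rightarrow>
     (nat \<Rightarrow> 'f, nat, nat \<Rightarrow> 'f, nat \<Rightarrow> 'f \<times> 'f) game" where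
  "stern_game n k w H s fe e1 e2 =
     \<lparr> quA = {1,2,3} \<rightarrow>\<^sub>E UNIV,
       quB = {1,2,3},
       ansA = (\<lambda>_. {1,2,3} \<rightarrow>\<^sub>E UNIV),
       ansB = (\<lambda>c. ({1,2,3} - {c}) \<rightarrow>\<^sub>E UNIV),
       wins = stern_wins n k w H s fe e1 e2 \<rparr>"

end

theory Submission
  imports Defs
begin

text \<open>Fix Alice's question \<open>b\<close> and answer \<open>y\<close>; they steer Bob's system to a mixture of vectors \<open>v\<close>, and
  Bob wins the challenge \<open>c\<close> with probability \<open>\<langle>W\<^sub>c v, v\<rangle>\<close>, where \<open>W\<^sub>c\<close> is the sum of the effects of
  his winning answers. A total above \<open>2\<close> over the three challenges forces
  \<open>T = W\<^sub>2 W\<^sub>1 v\<close> to have a sizeable \<open>\<langle>W\<^sub>3 T, T\<rangle>\<close>: up to normalisation, \<open>W\<^sub>1 v\<close> lies in the span of \<open>T\<close> and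
  the kernel of \<open>W\<^sub>2\<close>, so \<open>\<langle>W\<^sub>1 v, v\<rangle> + \<langle>W\<^sub>2 v, v\<rangle>\<close> exceeds \<open>1\<close> by at most the squared overlap of \<open>v\<close>
  with \<open>T\<close>, while \<open>\<langle>W\<^sub>3 v, v\<rangle>\<close> plus this squared overlap is at most \<open>1\<close> when \<open>W\<^sub>3\<close> annihilates \<open>T\<close>.
  Expanding \<open>W\<^sub>1\<close> and \<open>W\<^sub>2\<close> into single answers costs, by Cauchy-Schwarz, the number
  of winning answers, which is at most \<open>n! 2\<^sup>4\<^sup>n\<close> in total. But winning all three challenges in a row
  yields two different openings of some commitment, because consistent openings would give a solution of the
  syndrome decoding instance; two openings determine a coordinate of \<open>b\<close>, of which Bob knows
  nothing, so this happens with probability at most \<open>3 / Q\<close>.\<close>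

section \<open>Positive semidefinite matrices\<close>

lemma cscalar_mult_mat_vec:
  assumes "A \<in> carrier_mat d d" "x \<in> carrier_vec d" "y \<in> carrier_vec d"
  shows "(A *\<^sub>v x) \<bullet>c y = (\<Sum>i<d. \<Sum>j<d. A $$ (i, j) * x $ j * cnj (y $ i))"
  using assms
  by (simp add: scalar_prod_def mult_mat_vec_def sum_distrib_right row_def lessThan_atLeast0)

lemma quad_add_smult:
  fixes W :: "complex mat"
  assumes W: "W \<in> carrier_mat d d" and x: "x \<in> carrier_vec d" and y: "y \<in> carrier_vec d"
  shows "(W *\<^sub>v (x + c \<cdot>\<^sub>v y)) \<bullet>c (x + c \<cdot>\<^sub>v y) =
    (W *\<^sub>v x) \<bullet>c x + cnj c * ((W *\<^sub>v x) \<bullet>c y) + c * ((W *\<^sub>v y) \<bullet>c x)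
    + c * cnj c * ((W *\<^sub>v y) \<bullet>c y)"
proof -
  have "W *\<^sub>v (x + c \<cdot>\<^sub>v y) = W *\<^sub>v x + c \<cdot>\<^sub>v (W *\<^sub>v y)"
    using assms by (simp add: mult_add_distrib_mat_vec[of _ d d] mult_mat_vec[of _ d d])
  moreover have "W *\<^sub>v x \<in> carrier_vec d" "W *\<^sub>v y \<in> carrier_vec d"
    using assms by auto
  ultimately show ?thesis
    using assms
    by (simp add: conjugate_add_vec[of _ d] conjugate_smult_vec add_scalar_prod_distrib[of _ d]
        scalar_prod_add_distrib[of _ d] algebra_simps)
qed

lemma psd_matD:
  assumes "psd_mat d W"
  shows "W \<in> carrier_mat d d" and "v \<in> carrier_vec d \<Longrightarrow> 0 \<le> (W *\<^sub>v v) \<bullet>c v"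
  using assms by (auto simp: psd_mat_def)

lemma psd_mat_Re_nonneg: "psd_mat d W \<Longrightarrow> v \<in> carrier_vec d \<Longrightarrow> 0 \<le> Re ((W *\<^sub>v v) \<bullet>c v)"
  using psd_matD(2) by (fastforce simp: less_eq_complex_def)

text \<open>The form is real at \<open>x + c y\<close>; the choices \<open>c = 1\<close> and
  \<open>c = \<i>\<close> relate the imaginary and the real parts of the two mixed terms.\<close>

lemma psd_mat_hermitian:
  assumes W: "psd_mat d W" and x: "x \<in> carrier_vec d" and y: "y \<in> carrier_vec d"
  shows "(W *\<^sub>v y) \<bullet>c x = cnj ((W *\<^sub>v x) \<bullet>c y)"
proof -
  note Wc = psd_matD(1)[OF W]
  have "Im ((W *\<^sub>v (x + c \<cdot>\<^sub>v y)) \<bullet>c (x + c \<cdot>\<^sub>v y)) = 0" for c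
    using psd_matD(2)[OF W, of "x + c \<cdot>\<^sub>v y"] x y by (auto simp: less_eq_complex_def)
  from this[of 1] this[of \<i>] show ?thesis
    unfolding quad_add_smult[OF Wc x y]
    using psd_matD(2)[OF W x] psd_matD(2)[OF W y]
    by (auto simp: less_eq_complex_def complex_eq_iff)
qed

lemma cscalar_prod_commute:
  fixes x y :: "complex vec"
  assumes "x \<in> carrier_vec d" "y \<in> carrier_vec d"
  shows "x \<bullet>c y = cnj (y \<bullet>c x)"
  using assms by (auto simp: scalar_prod_def intro!: sum.cong)

lemma psd_mat_selfadjoint:
  assumes W: "psd_mat d W" and x: "x \<in> carrier_vec d" and y: "y \<in> carrier_vec d"
  shows "(W *\<^sub>v x) \<bullet>c y = x \<bullet>c (W *\<^sub>v y)"
proof -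
  have "W *\<^sub>v y \<in> carrier_vec d" using psd_matD(1)[OF W] y by auto
  then show ?thesis
    using psd_mat_hermitian[OF W y x] cscalar_prod_commute[of x d "W *\<^sub>v y"] x by simp
qed

section \<open>Discriminants of nonnegative forms\<close>

lemma Im_polarisation:
  assumes "\<And>t. Im (cnj t * s + t * r) = 0"
  shows "r = cnj s"
  using assms[of 1] assms[of \<i>] by (auto simp: complex_eq_iff)

text \<open>The value at the minimising \<open>c\<close> is nonnegative, which bounds the linear
  coefficient. Cauchy-Schwarz and the pivot step below both reduce to this.\<close>

lemma discriminant_complex:
  fixes a d :: real and b :: complex
  assumes pos: "\<And>c. 0 \<le> a + 2 * Re (cnj c * b) + (cmod c)\<^sup>2 * d" and d: "0 \<le> d"
  shows "(cmod b)\<^sup>2 \<le> a * d"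
proof (cases "d = 0")
  case True
  show ?thesis
  proof (rule ccontr)
    assume "\<not> ?thesis"
    then have b: "(cmod b)\<^sup>2 > 0" using True by simp
    \<comment> \<open>Without a quadratic term the form is unbounded below: this \<open>t\<close>
      turns it into \<open>- a - 2\<close>, while \<open>c = 0\<close> gives
      \<open>0 \<le> a\<close>.\<close>
    define t where "t = (a + 1) / (cmod b)\<^sup>2"
    have "0 \<le> a + 2 * Re (cnj (of_real (- t) * b) * b)" using pos[of "of_real (- t) * b"] True by simp
    also have "cnj (of_real (- t) * b) * b = of_real (- t * (cmod b)\<^sup>2)"
      by (simp add: complex_norm_square mult.commute del: of_real_power)
    finally have "0 \<le> a - 2 * (t * (cmod b)\<^sup>2)" by simp
    also have "t * (cmod b)\<^sup>2 = a + 1" using b by (simp add: t_def)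
    finally have "a + 2 \<le> 0" by simp
    moreover have "0 \<le> a" using pos[of 0] by simp
    ultimately show False by simp
  qed
next
  case False
  then have d: "d > 0" using d by simp
  \<comment> \<open>The minimiser of the form.\<close>
  define c where "c = of_real (- 1 / d) * b"
  have "cnj c * b = of_real (- (cmod b)\<^sup>2 / d)"
    by (simp add: c_def complex_norm_square mult.commute del: of_real_power)
  moreover have "(cmod c)\<^sup>2 * d = (cmod b)\<^sup>2 / d"
    using d by (simp add: c_def norm_mult norm_divide power_divide power2_eq_square)
  ultimately have "0 \<le> a - (cmod b)\<^sup>2 / d" using pos[of c] by simp
  then show ?thesis using d by (simp add: field_simps)
qed

text \<open>The discriminant bound in the shape met in a pivot step: \<open>t\<close> is the pivot
  coordinate, \<open>b\<close> the linear term and \<open>a\<close> the form in the other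
  coordinates.\<close>

lemma discriminant_form:
  fixes a b :: complex and d :: real
  assumes "\<And>t. 0 \<le> of_real d * t * cnj t + cnj t * b + t * cnj b + a" and "0 \<le> d"
  shows "(cmod b)\<^sup>2 \<le> Re a * d"
proof (rule discriminant_complex)
  fix c :: complex
  show "0 \<le> Re a + 2 * Re (cnj c * b) + (cmod c)\<^sup>2 * d"
    using assms(1)[of c] unfolding cmod_power2
    by (simp add: less_eq_complex_def power2_eq_square algebra_simps)
qed fact

text \<open>For \<open>m = 0\<close> the quotient is \<open>0\<close> by convention and only
  \<open>0 \<le> a\<close> is left; otherwise the first assumption is divided by
  \<open>m\<close>.\<close>

lemma schur_nonneg:
  assumes "r \<le> Re a * m" and "0 \<le> m" and "0 \<le> a"
  shows "0 \<le> a - of_real r / of_real m"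
  using assms by (cases "m = 0") (auto simp: less_eq_complex_def field_simps)

text \<open>The discriminant bound for the nonnegative form along the line
  \<open>x + c y\<close>.\<close>

lemma psd_mat_Cauchy_Schwarz:
  assumes W: "psd_mat d W" and x: "x \<in> carrier_vec d" and y: "y \<in> carrier_vec d"
  shows "(cmod ((W *\<^sub>v x) \<bullet>c y))\<^sup>2 \<le> Re ((W *\<^sub>v x) \<bullet>c x) * Re ((W *\<^sub>v y) \<bullet>c y)"
proof (rule discriminant_complex)
  fix c :: complex
  have "0 \<le> Re ((W *\<^sub>v (x + c \<cdot>\<^sub>v y)) \<bullet>c (x + c \<cdot>\<^sub>v y))"
    using x y by (intro psd_mat_Re_nonneg[OF W]) auto
  moreover have "Im ((W *\<^sub>v y) \<bullet>c y) = 0"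
    using psd_matD(2)[OF W y] by (auto simp: less_eq_complex_def)
  ultimately show "0 \<le> Re ((W *\<^sub>v x) \<bullet>c x) + 2 * Re (cnj c * ((W *\<^sub>v x) \<bullet>c y))
      + (cmod c)\<^sup>2 * Re ((W *\<^sub>v y) \<bullet>c y)"
    unfolding quad_add_smult[OF psd_matD(1)[OF W] x y] psd_mat_hermitian[OF W x y] cmod_power2
    by (simp add: power2_eq_square)
qed (use psd_mat_Re_nonneg[OF W y] in simp)

text \<open>A Cholesky factorisation: one pivot step splits off a rank-one matrix and leaves the Schur
  complement.\<close>

lemma pos_form_decomposition:
  fixes M :: "nat \<Rightarrow> nat \<Rightarrow> complex"
  assumes "finite S"
    and "\<And>x. 0 \<le> (\<Sum>i\<in>S. \<Sum>j\<in>S. M i j * x j * cnj (x i))"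
  shows "\<exists>V. \<forall>i\<in>S. \<forall>j\<in>S. M i j = (\<Sum>l\<in>S. V l i * cnj (V l j))"
  using assms
proof (induction S arbitrary: M rule: finite_induct)
  case empty
  then show ?case by simp
next
  case (insert p S)
  let ?s = "\<lambda>x. \<Sum>j\<in>S. M p j * x j"
  let ?r = "\<lambda>x. \<Sum>i\<in>S. M i p * cnj (x i)"
  let ?f = "\<lambda>x. \<Sum>i\<in>S. \<Sum>j\<in>S. M i j * x j * cnj (x i)"
  \<comment> \<open>Coordinate \<open>p\<close> is set to \<open>t\<close> and the others stay free;
    every fact about the pivot comes from choosing \<open>t\<close> and \<open>x\<close>
    here.\<close>
  have form: "0 \<le> M p p * t * cnj t + cnj t * ?s x + t * ?r x + ?f x" for x t
  proof -
    let ?x = "x(p := t)"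
    have "(\<Sum>i\<in>insert p S. \<Sum>j\<in>insert p S. M i j * ?x j * cnj (?x i))
        = (M p p * t * cnj t + (\<Sum>j\<in>S. M p j * ?x j * cnj t))
          + (\<Sum>i\<in>S. M i p * t * cnj (?x i) + (\<Sum>j\<in>S. M i j * ?x j * cnj (?x i)))"
      using insert.hyps by simp
    also have "(\<Sum>j\<in>S. M p j * ?x j * cnj t) = cnj t * ?s x"
      using insert.hyps unfolding sum_distrib_left by (intro sum.cong) (auto simp: ac_simps)
    also have "(\<Sum>i\<in>S. M i p * t * cnj (?x i) + (\<Sum>j\<in>S. M i j * ?x j * cnj (?x i)))
        = t * ?r x + ?f x"
      using insert.hyps unfolding sum_distrib_left sum.distrib
      by (intro arg_cong2[of _ _ _ _ plus] sum.cong) (auto simp: ac_simps)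
    finally show ?thesis using insert.prems[of ?x] by (simp add: ac_simps)
  qed
  have m0: "0 \<le> M p p" using form[where t = 1 and x = "\<lambda>_. 0"] by simp
  define m where "m = Re (M p p)"
  have m: "M p p = of_real m" "0 \<le> m"
    using m0 by (auto simp: m_def less_eq_complex_def complex_eq_iff)
  have f0: "0 \<le> ?f x" for x using form[where t = 0] by simp
  have rs: "?r x = cnj (?s x)" for x
  proof -
    have "Im (cnj t * ?s x + t * ?r x) = 0" for t
      using form[of t x] m f0[of x] by (auto simp: less_eq_complex_def)
    then show ?thesis by (rule Im_polarisation)
  qed
  have sbound: "(cmod (?s x))\<^sup>2 \<le> Re (?f x) * m" for x
    using form[of _ x] unfolding rs m(1) by (intro discriminant_form m(2))
  \<comment> \<open>Unit vectors reduce the linear forms to single entries. They show that row and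
    column of the pivot are conjugate and that both vanish with the pivot.\<close>
  have unit: "?s (\<lambda>i. if i = j then 1 else 0) = M p j"
    "?r (\<lambda>i. if i = j then 1 else 0) = M j p" if "j \<in> S" for j
    using that insert.hyps by (simp_all add: if_distrib sum.delta cong: if_cong)
  have col: "M p j = cnj (M j p)" if "j \<in> S" for j
    using rs[of "\<lambda>i. if i = j then 1 else 0"] unfolding unit[OF that] by simp
  have zero: "M p j = 0" if "m = 0" "j \<in> S" for j
    using sbound[of "\<lambda>i. if i = j then 1 else 0"] unfolding unit[OF that(2)] that(1) by simp
  \<comment> \<open>The Schur complement. For a zero pivot the division yields \<open>0\<close>, so
    \<open>?M\<close> is then just \<open>M\<close>.\<close>
  let ?M = "\<lambda>i j. M i j - M i p * M p j / of_real m"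
  have "0 \<le> (\<Sum>i\<in>S. \<Sum>j\<in>S. ?M i j * x j * cnj (x i))" for x
  proof -
    have "(\<Sum>i\<in>S. \<Sum>j\<in>S. ?M i j * x j * cnj (x i))
        = ?f x - (\<Sum>i\<in>S. \<Sum>j\<in>S. (M i p * cnj (x i)) * (M p j * x j) / of_real m)"
      unfolding sum_subtractf[symmetric] by (intro sum.cong refl) (simp add: left_diff_distrib)
    also have "(\<Sum>i\<in>S. \<Sum>j\<in>S. (M i p * cnj (x i)) * (M p j * x j) / of_real m)
        = ?r x * ?s x / of_real m"
      unfolding sum_product sum_divide_distrib ..
    also have "?r x * ?s x = of_real ((cmod (?s x))\<^sup>2)"
      unfolding rs complex_norm_square by (rule mult.commute)
    also have "0 \<le> ?f x - of_real ((cmod (?s x))\<^sup>2) / of_real m"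
      using m(2) f0[of x] by (intro schur_nonneg sbound)
    finally show ?thesis .
  qed
  from insert.IH[OF this] obtain V where
    V: "\<And>i j. i \<in> S \<Longrightarrow> j \<in> S \<Longrightarrow> ?M i j = (\<Sum>l\<in>S. V l i * cnj (V l j))"
    by blast
  \<comment> \<open>The new vector, indexed by \<open>p\<close>, is the pivot column scaled by the
    root of the pivot; the vectors from the induction are extended by \<open>0\<close> at
    \<open>p\<close>.\<close>
  define U where "U l i = (if l = p then M i p / of_real (sqrt m) else if i = p then 0 else V l i)"
    for l i
  have "M i j = (\<Sum>l\<in>insert p S. U l i * cnj (U l j))"
    if ij: "i \<in> insert p S" "j \<in> insert p S" for i j
  proof -
    have sq: "of_real (sqrt m) * of_real (sqrt m) = (of_real m :: complex)"
      using m(2) by (metis of_real_mult real_sqrt_mult_self abs_of_nonneg)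
    have pj: "cnj (M j p) = M p j" using col[of j] ij m(1) by (cases "j = p") auto
    have "(\<Sum>l\<in>insert p S. U l i * cnj (U l j))
        = M i p * M p j / of_real m + (\<Sum>l\<in>S. if i = p \<or> j = p then 0 else V l i * cnj (V l j))"
    proof -
      have "U p i * cnj (U p j) = M i p * M p j / of_real m"
        unfolding U_def by (simp add: pj sq)
      moreover have "(\<Sum>l\<in>S. U l i * cnj (U l j))
          = (\<Sum>l\<in>S. if i = p \<or> j = p then 0 else V l i * cnj (V l j))"
        using insert.hyps by (intro sum.cong) (auto simp: U_def)
      ultimately show ?thesis using insert.hyps by simp
    qed
    also have "\<dots> = M i j"
    proof (cases "i = p \<or> j = p")
      case True
      then show ?thesis
        using m zero[of i] zero[of j] col[of i] ij by (cases "m = 0") auto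
    next
      case False
      then have "(\<Sum>l\<in>S. V l i * cnj (V l j)) = M i j - M i p * M p j / of_real m"
        using V[of i j] ij by auto
      then show ?thesis using False by simp
    qed
    finally show ?thesis by simp
  qed
  then show ?case by blast
qed

text \<open>Serves to factor both the shared state and Alice's effect when Bob's steered vectors are
  constructed.\<close>

lemma psd_mat_decomposition:
  assumes "psd_mat d M"
  obtains V where "\<And>i j. i < d \<Longrightarrow> j < d \<Longrightarrow> M $$ (i, j) = (\<Sum>l<d. V l i * cnj (V l j))"
proof -
  have "0 \<le> (\<Sum>i<d. \<Sum>j<d. M $$ (i, j) * x j * cnj (x i))" for x
    using psd_matD(2)[OF assms, of "vec d x"] cscalar_mult_mat_vec[OF psd_matD(1)[OF assms], of "vec d x" "vec d x"]
    by simp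
  from pos_form_decomposition[where M = "\<lambda>i j. M $$ (i, j)", OF finite_lessThan this] that show thesis
    by blast
qed

section \<open>Three effects\<close>

text \<open>Cauchy-Schwarz in the plane for \<open>(sqrt a, sqrt c)\<close> and
  \<open>(sqrt b, sqrt d)\<close>.\<close>

lemma sqrt_mult_sum_le:
  fixes a b c d :: real
  assumes "0 \<le> a" "0 \<le> b" "0 \<le> c" "0 \<le> d"
  shows "(sqrt (a * b) + sqrt (c * d))\<^sup>2 \<le> (a + c) * (b + d)"
proof -
  have "2 * (sqrt (a * d) * sqrt (b * c)) \<le> (sqrt (a * d))\<^sup>2 + (sqrt (b * c))\<^sup>2"
    by (rule sum_squares_bound[of "sqrt (a * d)" "sqrt (b * c)", simplified mult.assoc])
  moreover have "sqrt (a * d) * sqrt (b * c) = sqrt (a * b) * sqrt (c * d)"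
    by (simp add: real_sqrt_mult[symmetric] ac_simps)
  ultimately show ?thesis
    using assms by (simp add: power2_sum algebra_simps)
qed

text \<open>In the application \<open>N\<close> is the squared norm of \<open>v\<close>,
  \<open>p1\<close>, \<open>p2\<close>, \<open>p3\<close> are the values of the three effects at
  \<open>v\<close>, \<open>G\<close> is the squared norm of \<open>T\<close>, \<open>t\<close> is
  the overlap of \<open>T\<close> with \<open>v\<close>, and \<open>\<eta>\<close> is the value of
  the third effect at \<open>T\<close>. The bounds \<open>F \<le> sqrt (\<eta> / G) * N\<close> and
  \<open>F \<le> 2 * sqrt (G * N)\<close> are multiplied, so that \<open>G\<close> cancels.\<close>

lemma three_effects_real:
  fixes N p1 p2 p3 G t \<eta> :: real
  assumes p: "0 \<le> p1" "p1 \<le> N" "0 \<le> p2" "p2 \<le> N" "0 \<le> p3" "p3 \<le> N"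
    and G: "0 \<le> \<eta>" "\<eta> \<le> G" "G \<le> p1" and t: "0 \<le> t" "t\<^sup>2 \<le> G * N"
    and first: "p1 \<le> t + sqrt ((N - p2) * (p1 - G))"
    and last: "t \<le> sqrt (p3 * \<eta>) + sqrt ((N - p3) * (G - \<eta>))"
    and F: "F = p1 + p2 + p3 - 2 * N" "0 < F"
  shows "F ^ 4 \<le> 4 * N ^ 3 * \<eta>"
proof -
  \<comment> \<open>\<open>G = 0\<close> forces \<open>t = 0\<close>, and then \<open>first\<close>
    contradicts \<open>0 < F\<close>.\<close>
  have "G \<noteq> 0"
  proof
    assume "G = 0"
    then have "p1\<^sup>2 \<le> (N - p2) * p1"
      using first t p power_mono[of p1 "sqrt ((N - p2) * p1)" 2] by auto
    then have "p1 \<le> N - p2 \<or> p1 = 0"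
      using p by (auto simp: power2_eq_square mult_le_cancel_right)
    then show False using p F by auto
  qed
  then have G0: "0 < G" using G by auto
  have N0: "0 < N" using G0 G p by linarith
  have bound1: "p1 + p2 - N \<le> t\<^sup>2 / G"
  proof -
    have "p1\<^sup>2 \<le> (sqrt (t\<^sup>2 / G * G) + sqrt ((N - p2) * (p1 - G)))\<^sup>2"
      using first t p G0 by (intro power_mono) auto
    also have "\<dots> \<le> (t\<^sup>2 / G + (N - p2)) * (G + (p1 - G))"
      using p G G0 by (intro sqrt_mult_sum_le) auto
    finally have "p1 * p1 \<le> (t\<^sup>2 / G + (N - p2)) * p1"
      by (simp add: power2_eq_square)
    then show ?thesis using G0 G by (simp add: mult_le_cancel_right)
  qed
  define h where "h = sqrt (\<eta> / G)"
  have h: "0 \<le> h" "h\<^sup>2 = \<eta> / G" "h \<le> 1" "\<eta> = G * h\<^sup>2"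
    using G G0 by (auto simp: h_def)
  have bound2: "t\<^sup>2 / G + p3 - N \<le> h * N"
  proof -
    \<comment> \<open>\<open>(h, k)\<close> is a unit vector and \<open>(x, y)\<close> has squared
      length \<open>N\<close>; \<open>last\<close> says that \<open>t\<close> is at most
      \<open>sqrt G\<close> times their inner product.\<close>
    define x y k where "x = sqrt p3" and "y = sqrt (N - p3)" and "k = sqrt (1 - h\<^sup>2)"
    have sq: "x\<^sup>2 = p3" "y\<^sup>2 = N - p3" "k\<^sup>2 = 1 - h\<^sup>2" "0 \<le> x" "0 \<le> y" "0 \<le> k"
      using p h by (auto simp: x_def y_def k_def power_le_one)
    have "sqrt (p3 * \<eta>) = sqrt G * (h * x)"
      using h by (simp add: h(4) x_def real_sqrt_mult real_sqrt_abs)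
    moreover have "sqrt ((N - p3) * (G - \<eta>)) = sqrt G * (k * y)"
    proof -
      have "G - \<eta> = G * (1 - h\<^sup>2)" using h by (simp add: algebra_simps)
      then show ?thesis by (simp add: k_def y_def real_sqrt_mult)
    qed
    ultimately have "t \<le> sqrt G * (h * x + k * y)" using last by (simp add: distrib_left)
    then have "t\<^sup>2 \<le> (sqrt G * (h * x + k * y))\<^sup>2" using t by (intro power_mono) auto
    also have "\<dots> = (h * x + k * y)\<^sup>2 * G" using G0 by (simp add: power_mult_distrib)
    finally have "t\<^sup>2 / G \<le> (h * x + k * y)\<^sup>2" using G0 by (simp add: divide_le_eq)
    also have "(h * x + k * y)\<^sup>2 = h\<^sup>2 * x\<^sup>2 + k\<^sup>2 * y\<^sup>2 + 2 * h * k * x * y"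
      by (simp add: power2_eq_square algebra_simps)
    also have "\<dots> = N - p3 + h * (h * (x\<^sup>2 - y\<^sup>2) + k * (2 * x * y))"
      unfolding sq by (simp add: power2_eq_square algebra_simps)
    also have "h * (h * (x\<^sup>2 - y\<^sup>2) + k * (2 * x * y)) \<le> h * N"
    proof (rule mult_left_mono[OF _ h(1)])
      \<comment> \<open>Lagrange's identity for \<open>(h, k)\<close> and
        \<open>(x\<^sup>2 - y\<^sup>2, 2 * x * y)\<close>; the latter vector has length
        \<open>x\<^sup>2 + y\<^sup>2 = N\<close>.\<close>
      have "(h * (x\<^sup>2 - y\<^sup>2) + k * (2 * x * y))\<^sup>2 + (k * (x\<^sup>2 - y\<^sup>2) - h * (2 * x * y))\<^sup>2
          = (h\<^sup>2 + k\<^sup>2) * (x\<^sup>2 + y\<^sup>2)\<^sup>2"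
        by (simp add: power2_eq_square algebra_simps)
      also have "\<dots> = N\<^sup>2" unfolding sq by simp
      finally have "(h * (x\<^sup>2 - y\<^sup>2) + k * (2 * x * y))\<^sup>2 \<le> N\<^sup>2"
        by (metis le_add_same_cancel1 zero_le_power2)
      then show "h * (x\<^sup>2 - y\<^sup>2) + k * (2 * x * y) \<le> N"
        using N0 by (auto intro: power2_le_imp_le[OF _ less_imp_le])
    qed
    finally show ?thesis by simp
  qed
  from bound1 bound2 have low: "F \<le> h * N" unfolding F by simp
  \<comment> \<open>The second estimate bounds \<open>t\<close> by Cauchy-Schwarz and the root in
    \<open>first\<close> by an arithmetic mean; it is the strong one when \<open>G\<close> is
    small.\<close>
  have tN: "t \<le> sqrt (G * N)" using t by (simp add: real_le_rsqrt)
  have "sqrt ((N - p2) * (p1 - G)) \<le> sqrt ((N - p2) * p1)"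
    using p G G0 by (intro real_sqrt_le_mono mult_left_mono) auto
  also have "\<dots> \<le> (N - p2 + p1) / 2"
    using p arith_geo_mean_sqrt[of "N - p2" p1] by simp
  finally have "p1 \<le> sqrt (G * N) + (N - p2 + p1) / 2" using first tN by argo
  then have high: "F \<le> 2 * sqrt (G * N)" using p F(1) by argo
  have "F\<^sup>2 \<le> (h * N) * (2 * sqrt (G * N))"
    unfolding power2_eq_square using low high F by (intro mult_mono) auto
  then have "(F\<^sup>2)\<^sup>2 \<le> ((h * N) * (2 * sqrt (G * N)))\<^sup>2" by (intro power_mono) auto
  also have "\<dots> = 4 * N\<^sup>2 * (h\<^sup>2 * (sqrt (G * N))\<^sup>2)"
    by (simp add: power_mult_distrib)
  also have "\<dots> = 4 * N ^ 3 * \<eta>"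
    using G0 N0 by (simp add: h(4) power3_eq_cube power2_eq_square)
  finally show ?thesis by simp
qed

text \<open>The inequality of arithmetic and geometric means for \<open>x, x, x, y\<close>.\<close>

lemma amgm_3_1:
  fixes x y F :: real
  assumes "0 \<le> x" "0 \<le> y" and F: "F ^ 4 \<le> x ^ 3 * y"
  shows "F \<le> (3 * x + y) / 4"
proof (rule power_le_imp_le_base[where n = 3])
  \<comment> \<open>The difference of the fourth powers has a double root at \<open>x = y\<close>;
    the cofactor has nonnegative coefficients.\<close>
  have "0 \<le> (x - y)\<^sup>2 * (81 * x\<^sup>2 + 14 * (x * y) + y\<^sup>2)"
    using assms by simp
  also have "\<dots> = (3 * x + y) ^ 4 - 256 * (x ^ 3 * y)"
    by (simp add: power2_eq_square power4_eq_xxxx power3_eq_cube algebra_simps)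
  finally show "F ^ Suc 3 \<le> ((3 * x + y) / 4) ^ Suc 3"
    using F by (simp add: power_divide)
qed (use assms in simp)

text \<open>The product \<open>4 * N ^ 3 * \<eta>\<close> is split as
  \<open>(l * N) ^ 3 * (4 * \<eta> / l ^ 3)\<close> before taking means. For
  \<open>F \<le> 0\<close> the right-hand side is nonnegative anyway.\<close>

lemma three_effects_linear:
  fixes N p1 p2 p3 F \<eta> l :: real
  assumes N: "0 \<le> N" and e: "0 \<le> \<eta>" and l: "0 < l"
    and F: "0 < F \<Longrightarrow> F ^ 4 \<le> 4 * N ^ 3 * \<eta>"
  shows "F \<le> 3 / 4 * l * N + \<eta> / l ^ 3"
proof (cases "0 < F")
  case True
  have "F ^ 4 \<le> (l * N) ^ 3 * (4 * \<eta> / l ^ 3)"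
    using F[OF True] l by (simp add: power_mult_distrib)
  then have "F \<le> (3 * (l * N) + 4 * \<eta> / l ^ 3) / 4"
    using N e l by (intro amgm_3_1) auto
  then show ?thesis by (simp add: field_simps)
next
  case False
  moreover have "0 \<le> 3 / 4 * l * N + \<eta> / l ^ 3" using N e l by simp
  ultimately show ?thesis by linarith
qed

section \<open>Effects and the estimate for a single vector\<close>

definition effect :: "nat \<Rightarrow> complex mat \<Rightarrow> bool" where
  "effect d W \<longleftrightarrow> psd_mat d W \<and> psd_mat d (1\<^sub>m d - W)"

lemma psd_mat_one: "psd_mat d (1\<^sub>m d)"
  by (auto simp: psd_mat_def intro: conjugate_square_ge_0_vec)

lemma cscalar_one_minus:
  fixes W :: "complex mat"
  assumes "W \<in> carrier_mat d d" "x \<in> carrier_vec d" "y \<in> carrier_vec d"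
  shows "((1\<^sub>m d - W) *\<^sub>v x) \<bullet>c y = x \<bullet>c y - (W *\<^sub>v x) \<bullet>c y"
proof -
  have "(1\<^sub>m d - W) *\<^sub>v x = x - W *\<^sub>v x"
    using assms by (simp add: minus_mult_distrib_mat_vec[of _ d d])
  moreover have "W *\<^sub>v x \<in> carrier_vec d" using assms by auto
  ultimately show ?thesis using assms by (simp add: minus_scalar_prod_distrib[of _ d])
qed

lemma effect_le:
  assumes W: "effect d W" and x: "x \<in> carrier_vec d"
  shows "Re ((W *\<^sub>v x) \<bullet>c x) \<le> Re (x \<bullet>c x)"
  using psd_mat_Re_nonneg[of d "1\<^sub>m d - W" x] cscalar_one_minus[of W d x x] assms
  by (simp add: effect_def psd_mat_def)

lemma cscalar_self_Re: "x \<in> carrier_vec d \<Longrightarrow> 0 \<le> Re (x \<bullet>c x)" for x :: "complex vec"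
  using psd_mat_Re_nonneg[OF psd_mat_one, of x d] by simp

text \<open>The square of an effect lies below the effect: Cauchy-Schwarz for the form of
  \<open>W\<close> at \<open>x\<close> and \<open>W x\<close>, then \<open>W \<le> 1\<close>, then
  one factor cancels.\<close>

lemma effect_sq_le:
  assumes W: "effect d W" and x: "x \<in> carrier_vec d"
  shows "Re ((W *\<^sub>v x) \<bullet>c (W *\<^sub>v x)) \<le> Re ((W *\<^sub>v x) \<bullet>c x)"
proof -
  have psd: "psd_mat d W" using W by (simp add: effect_def)
  let ?y = "W *\<^sub>v x"
  have y: "?y \<in> carrier_vec d" using psd_matD(1)[OF psd] x by auto
  let ?a = "Re (?y \<bullet>c ?y)"
  have "?a\<^sup>2 \<le> (cmod (?y \<bullet>c ?y))\<^sup>2"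
    by (metis abs_Re_le_cmod power2_abs power_mono abs_ge_zero)
  also have "\<dots> \<le> Re (?y \<bullet>c x) * Re ((W *\<^sub>v ?y) \<bullet>c ?y)"
    by (rule psd_mat_Cauchy_Schwarz[OF psd x y])
  also have "\<dots> \<le> Re (?y \<bullet>c x) * ?a"
    using psd_mat_Re_nonneg[OF psd x] effect_le[OF W y] by (rule mult_left_mono[rotated])
  finally have "?a * ?a \<le> Re (?y \<bullet>c x) * ?a" by (simp add: power2_eq_square)
  then show ?thesis
    using cscalar_self_Re[OF y] psd_mat_Re_nonneg[OF psd x]
    by (cases "?a = 0") (auto simp: mult_le_cancel_right)
qed

lemma psd_cmod_le:
  assumes W: "psd_mat d W" and x: "x \<in> carrier_vec d" and y: "y \<in> carrier_vec d"
  shows "cmod ((W *\<^sub>v x) \<bullet>c y) \<le> sqrt (Re ((W *\<^sub>v x) \<bullet>c x) * Re ((W *\<^sub>v y) \<bullet>c y))"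
  using psd_mat_Cauchy_Schwarz[OF assms] by (rule real_le_rsqrt)

text \<open>The parameter \<open>l\<close> linearises the bound \<open>F ^ 4 \<le> 4 * N ^ 3 * \<eta>\<close>, so that the estimate can be
  summed over the vectors of a mixture.\<close>

lemma three_effects:
  assumes W1: "effect d W1" and W2: "effect d W2" and W3: "effect d W3" and v: "v \<in> carrier_vec d"
    and F: "F = Re ((W1 *\<^sub>v v) \<bullet>c v) + Re ((W2 *\<^sub>v v) \<bullet>c v) + Re ((W3 *\<^sub>v v) \<bullet>c v) - 2 * Re (v \<bullet>c v)"
    and T: "T = W2 *\<^sub>v (W1 *\<^sub>v v)" and l: "0 < l"
  shows "F \<le> 3 / 4 * l * Re (v \<bullet>c v) + Re ((W3 *\<^sub>v T) \<bullet>c T) / l ^ 3"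
proof -
  have psd: "psd_mat d W1" "psd_mat d W2" "psd_mat d W3" "psd_mat d (1\<^sub>m d - W2)" "psd_mat d (1\<^sub>m d - W3)"
    using W1 W2 W3 by (auto simp: effect_def)
  note car = psd(1-3)[THEN psd_matD(1)]
  define V where "V = W1 *\<^sub>v v"
  have Vc: "V \<in> carrier_vec d" and Tc: "T \<in> carrier_vec d"
    using car v by (auto simp: V_def T)
  let ?N = "Re (v \<bullet>c v)" and ?G = "Re (T \<bullet>c T)" and ?e = "Re ((W3 *\<^sub>v T) \<bullet>c T)"
  let ?p = "\<lambda>W. Re ((W *\<^sub>v v) \<bullet>c v)"
  have TW: "T = W2 *\<^sub>v V" by (simp add: T V_def)
  have GV: "?G \<le> Re ((W2 *\<^sub>v V) \<bullet>c V)" unfolding TW by (rule effect_sq_le[OF W2 Vc])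
  have VV: "Re (V \<bullet>c V) \<le> ?p W1" unfolding V_def by (rule effect_sq_le[OF W1 v])
  \<comment> \<open>\<open>V\<close> is split into \<open>T\<close> and \<open>(1 - W2) V\<close>.
    The second part is paired with \<open>v\<close> by Cauchy-Schwarz for \<open>1 - W2\<close>,
    whose value at \<open>V\<close> is at most \<open>?p W1 - ?G\<close> by \<open>VV\<close> and
    \<open>GV\<close>.\<close>
  have first: "?p W1 \<le> cmod (T \<bullet>c v) + sqrt ((?N - ?p W2) * (?p W1 - ?G))"
  proof -
    have "V \<bullet>c v = T \<bullet>c v + ((1\<^sub>m d - W2) *\<^sub>v V) \<bullet>c v"
      using cscalar_one_minus[OF car(2) Vc v] TW by simp
    then have "?p W1 \<le> cmod (T \<bullet>c v) + cmod (((1\<^sub>m d - W2) *\<^sub>v V) \<bullet>c v)"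
      unfolding V_def by (metis complex_Re_le_cmod norm_triangle_ineq order_trans)
    also have "cmod (((1\<^sub>m d - W2) *\<^sub>v V) \<bullet>c v)
        \<le> sqrt (Re (((1\<^sub>m d - W2) *\<^sub>v V) \<bullet>c V) * Re (((1\<^sub>m d - W2) *\<^sub>v v) \<bullet>c v))"
      by (rule psd_cmod_le[OF psd(4) Vc v])
    also have "\<dots> \<le> sqrt ((?p W1 - ?G) * (?N - ?p W2))"
      using cscalar_one_minus[OF car(2) Vc Vc] cscalar_one_minus[OF car(2) v v] GV VV
        effect_le[OF W2 v] effect_le[OF W2 Vc]
      by (intro real_sqrt_le_mono mult_mono) auto
    finally show ?thesis by (simp add: mult.commute)
  qed
  \<comment> \<open>The same splitting of \<open>T\<close> by \<open>W3\<close> and its complement,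
    with Cauchy-Schwarz on either part.\<close>
  have last: "cmod (T \<bullet>c v) \<le> sqrt (?p W3 * ?e) + sqrt ((?N - ?p W3) * (?G - ?e))"
  proof -
    have "T \<bullet>c v = (W3 *\<^sub>v T) \<bullet>c v + ((1\<^sub>m d - W3) *\<^sub>v T) \<bullet>c v"
      using cscalar_one_minus[OF car(3) Tc v] by simp
    then have "cmod (T \<bullet>c v) \<le> cmod ((W3 *\<^sub>v T) \<bullet>c v) + cmod (((1\<^sub>m d - W3) *\<^sub>v T) \<bullet>c v)"
      by (metis norm_triangle_ineq)
    also have "\<dots> \<le> sqrt (?e * ?p W3) + sqrt ((?G - ?e) * (?N - ?p W3))"
      using psd_cmod_le[OF psd(3) Tc v] psd_cmod_le[OF psd(5) Tc v]
        cscalar_one_minus[OF car(3) Tc Tc] cscalar_one_minus[OF car(3) v v] by simp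
    finally show ?thesis by (simp add: mult.commute)
  qed
  have tt: "(cmod (T \<bullet>c v))\<^sup>2 \<le> ?G * ?N"
    using psd_mat_Cauchy_Schwarz[OF psd_mat_one Tc v] Tc v by simp
  have Gp: "?G \<le> ?p W1" using GV effect_le[OF W2 Vc] VV by linarith
  show ?thesis
  proof (rule three_effects_linear[OF cscalar_self_Re[OF v] psd_mat_Re_nonneg[OF psd(3) Tc] l])
    assume "0 < F"
    then show "F ^ 4 \<le> 4 * ?N ^ 3 * ?e"
      using three_effects_real[OF psd_mat_Re_nonneg[OF psd(1) v] effect_le[OF W1 v]
          psd_mat_Re_nonneg[OF psd(2) v] effect_le[OF W2 v] psd_mat_Re_nonneg[OF psd(3) v]
          effect_le[OF W3 v] psd_mat_Re_nonneg[OF psd(3) Tc] effect_le[OF W3 Tc] Gp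
          norm_ge_zero tt first last F]
      by blast
  qed
qed

section \<open>Sums of effects and consecutive measurements\<close>

text \<open>The sum is entrywise at a fixed dimension, which is the shape of the completeness
  condition in \<open>povm\<close>.\<close>

definition msum :: "nat \<Rightarrow> 'a set \<Rightarrow> ('a \<Rightarrow> complex mat) \<Rightarrow> complex mat" where
  "msum d V M = mat d d (\<lambda>ij. \<Sum>a\<in>V. M a $$ ij)"

lemma msum_carrier [simp]: "msum d V M \<in> carrier_mat d d"
  by (simp add: msum_def)

lemma povm_msum: "povm d S M \<longleftrightarrow> (\<forall>a\<in>S. psd_mat d (M a)) \<and> msum d S M = 1\<^sub>m d"
  by (simp add: povm_def msum_def)

lemma msum_cscalar:
  assumes M: "\<And>a. a \<in> V \<Longrightarrow> M a \<in> carrier_mat d d" and x: "x \<in> carrier_vec d" and y: "y \<in> carrier_vec d"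
  shows "(msum d V M *\<^sub>v x) \<bullet>c y = (\<Sum>a\<in>V. (M a *\<^sub>v x) \<bullet>c y)"
proof -
  have "(msum d V M *\<^sub>v x) \<bullet>c y = (\<Sum>i<d. \<Sum>j<d. \<Sum>a\<in>V. M a $$ (i, j) * x $ j * cnj (y $ i))"
    unfolding cscalar_mult_mat_vec[OF msum_carrier x y]
    by (intro sum.cong refl) (simp add: msum_def sum_distrib_right)
  also have "\<dots> = (\<Sum>a\<in>V. \<Sum>i<d. \<Sum>j<d. M a $$ (i, j) * x $ j * cnj (y $ i))"
    by (subst (2) sum.swap, intro sum.cong refl, rule sum.swap)
  also have "\<dots> = (\<Sum>a\<in>V. (M a *\<^sub>v x) \<bullet>c y)"
    by (intro sum.cong refl cscalar_mult_mat_vec[symmetric] M x y)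
  finally show ?thesis .
qed

lemma psd_mat_msum:
  assumes "\<And>a. a \<in> V \<Longrightarrow> psd_mat d (M a)"
  shows "psd_mat d (msum d V M)"
  unfolding psd_mat_def
  using assms
  by (auto simp: msum_cscalar psd_matD(1) intro!: sum_nonneg intro: psd_matD(2))

text \<open>The complement is the sum over the remaining answers \<open>S - V\<close>.\<close>

lemma effect_msum:
  assumes M: "povm d S M" and S: "finite S" and V: "V \<subseteq> S"
  shows "effect d (msum d V M)"
proof -
  have psd: "\<And>a. a \<in> S \<Longrightarrow> psd_mat d (M a)" using M by (simp add: povm_def)
  have "1\<^sub>m d - msum d V M = msum d (S - V) M"
  proof (rule eq_matI)
    fix i j assume ij: "i < dim_row (msum d (S - V) M)" "j < dim_col (msum d (S - V) M)"
    have "msum d S M $$ (i, j) = 1\<^sub>m d $$ (i, j)" using M by (simp add: povm_msum)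
    then show "(1\<^sub>m d - msum d V M) $$ (i, j) = msum d (S - V) M $$ (i, j)"
      using ij S V by (simp add: msum_def sum_diff)
  qed (auto simp: msum_def)
  then show ?thesis
    using psd V by (auto simp: effect_def intro!: psd_mat_msum)
qed

lemma effect_povm:
  assumes M: "povm d S M" and S: "finite S" and a: "a \<in> S"
  shows "effect d (M a)"
proof -
  have "msum d {a} M = M a"
    using M a by (auto simp: povm_def psd_mat_def msum_def intro!: eq_matI)
  then show ?thesis using effect_msum[OF M S, of "{a}"] a by simp
qed

lemma povm_complete:
  assumes M: "povm d S M" and x: "x \<in> carrier_vec d"
  shows "(\<Sum>a\<in>S. Re ((M a *\<^sub>v x) \<bullet>c x)) = Re (x \<bullet>c x)"
proof -
  have "(msum d S M *\<^sub>v x) \<bullet>c x = (\<Sum>a\<in>S. (M a *\<^sub>v x) \<bullet>c x)"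
    using M by (intro msum_cscalar x) (auto simp: povm_def psd_mat_def)
  then show ?thesis using M x by (simp add: povm_msum)
qed

text \<open>\<open>B\<close> is self-adjoint, so its outer copy moves to the other argument of the
  form.\<close>

lemma psd_mat_sandwich:
  assumes B: "psd_mat d B" and P: "psd_mat d P"
  shows "psd_mat d (B * (P * B))"
    and "x \<in> carrier_vec d \<Longrightarrow> ((B * (P * B)) *\<^sub>v x) \<bullet>c x = (P *\<^sub>v (B *\<^sub>v x)) \<bullet>c (B *\<^sub>v x)"
proof -
  note car = psd_matD(1)[OF B] psd_matD(1)[OF P]
  have *: "((B * (P * B)) *\<^sub>v x) \<bullet>c x = (P *\<^sub>v (B *\<^sub>v x)) \<bullet>c (B *\<^sub>v x)"
    if x: "x \<in> carrier_vec d" for x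
  proof -
    have "(B * (P * B)) *\<^sub>v x = B *\<^sub>v (P *\<^sub>v (B *\<^sub>v x))"
      using car x by (simp add: assoc_mult_mat_vec[of _ d d _ d])
    then show ?thesis
      using car x psd_mat_selfadjoint[OF B, of "P *\<^sub>v (B *\<^sub>v x)" x] by auto
  qed
  show "x \<in> carrier_vec d \<Longrightarrow> ((B * (P * B)) *\<^sub>v x) \<bullet>c x = (P *\<^sub>v (B *\<^sub>v x)) \<bullet>c (B *\<^sub>v x)"
    by (rule *)
  show "psd_mat d (B * (P * B))"
    unfolding psd_mat_def using car psd_matD(2)[OF P] by (auto simp: *)
qed

text \<open>Each mixed term of the expanded form is at most the mean of two diagonal terms, so every
  diagonal term is counted \<open>card V\<close> times. This is the price of reading out which
  answer occurred.\<close>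

lemma quad_msum_le:
  assumes P: "psd_mat d P" and M: "\<And>a. a \<in> V \<Longrightarrow> M a \<in> carrier_mat d d" and x: "x \<in> carrier_vec d"
  shows "Re ((P *\<^sub>v (msum d V M *\<^sub>v x)) \<bullet>c (msum d V M *\<^sub>v x))
    \<le> real (card V) * (\<Sum>a\<in>V. Re ((P *\<^sub>v (M a *\<^sub>v x)) \<bullet>c (M a *\<^sub>v x)))"
proof -
  let ?S = "msum d V M *\<^sub>v x" and ?u = "\<lambda>a. M a *\<^sub>v x"
  let ?q = "\<lambda>a. Re ((P *\<^sub>v ?u a) \<bullet>c ?u a)"
  have Sc: "?S \<in> carrier_vec d" using x by (simp add: mult_mat_vec_carrier[OF msum_carrier])
  have u: "?u a \<in> carrier_vec d" if "a \<in> V" for a using M[OF that] x by auto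
  have Pc: "P *\<^sub>v w \<in> carrier_vec d" if "w \<in> carrier_vec d" for w
    using psd_matD(1)[OF P] that by auto
  have expand: "(P *\<^sub>v ?S) \<bullet>c w = (\<Sum>a\<in>V. (P *\<^sub>v ?u a) \<bullet>c w)" if w: "w \<in> carrier_vec d" for w
  proof -
    have "(P *\<^sub>v ?S) \<bullet>c w = ?S \<bullet>c (P *\<^sub>v w)" by (rule psd_mat_selfadjoint[OF P Sc w])
    also have "\<dots> = (\<Sum>a\<in>V. ?u a \<bullet>c (P *\<^sub>v w))" by (rule msum_cscalar[OF M x Pc[OF w]])
    also have "\<dots> = (\<Sum>a\<in>V. (P *\<^sub>v ?u a) \<bullet>c w)"
      by (intro sum.cong refl psd_mat_selfadjoint[OF P _ w, symmetric] u)
    finally show ?thesis .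
  qed
  have "(P *\<^sub>v ?S) \<bullet>c ?S = (\<Sum>a\<in>V. (P *\<^sub>v ?u a) \<bullet>c ?S)" by (rule expand[OF Sc])
  also have "\<dots> = (\<Sum>a\<in>V. cnj ((P *\<^sub>v ?S) \<bullet>c ?u a))"
    by (intro sum.cong refl psd_mat_hermitian[OF P Sc] u)
  also have "\<dots> = (\<Sum>a\<in>V. \<Sum>b\<in>V. cnj ((P *\<^sub>v ?u b) \<bullet>c ?u a))"
    using expand u by (intro sum.cong refl) simp
  finally have "Re ((P *\<^sub>v ?S) \<bullet>c ?S) = (\<Sum>a\<in>V. \<Sum>b\<in>V. Re ((P *\<^sub>v ?u b) \<bullet>c ?u a))"
    by simp
  also have "\<dots> \<le> (\<Sum>a\<in>V. \<Sum>b\<in>V. (?q b + ?q a) / 2)"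
  proof (intro sum_mono)
    fix a b assume ab: "a \<in> V" "b \<in> V"
    have "Re ((P *\<^sub>v ?u b) \<bullet>c ?u a) \<le> sqrt (?q b * ?q a)"
      using psd_cmod_le[OF P u u, OF ab(2) ab(1)] complex_Re_le_cmod order_trans by blast
    also have "\<dots> \<le> (?q b + ?q a) / 2"
      using psd_mat_Re_nonneg[OF P u] ab by (intro arith_geo_mean_sqrt) auto
    finally show "Re ((P *\<^sub>v ?u b) \<bullet>c ?u a) \<le> (?q b + ?q a) / 2" .
  qed
  also have "\<dots> = real (card V) * (\<Sum>a\<in>V. ?q a)"
    by (simp add: sum.distrib sum_divide_distrib[symmetric] sum_distrib_left[symmetric])
  finally show ?thesis .
qed

section \<open>Reading out three answers in a row\<close>

text \<open>The product \<open>A B C B A\<close>, bracketed as two nested sandwiches. The effects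
  themselves, not their square roots, update the vector, so the total over all outcomes need not
  reach \<open>1\<close>.\<close>

definition consecutive :: "complex mat \<Rightarrow> complex mat \<Rightarrow> complex mat \<Rightarrow> complex mat" where
  "consecutive A B C = A * ((B * (C * B)) * A)"

lemma consecutive:
  assumes A: "psd_mat d A" and B: "psd_mat d B" and C: "psd_mat d C"
  shows "psd_mat d (consecutive A B C)"
    and "x \<in> carrier_vec d \<Longrightarrow> (consecutive A B C *\<^sub>v x) \<bullet>c x
      = (C *\<^sub>v (B *\<^sub>v (A *\<^sub>v x))) \<bullet>c (B *\<^sub>v (A *\<^sub>v x))"
proof -
  note BCB = psd_mat_sandwich[OF B C]
  show "psd_mat d (consecutive A B C)"
    unfolding consecutive_def by (rule psd_mat_sandwich(1)[OF A BCB(1)])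
  assume x: "x \<in> carrier_vec d"
  then have "A *\<^sub>v x \<in> carrier_vec d" using psd_matD(1)[OF A] by auto
  then show "(consecutive A B C *\<^sub>v x) \<bullet>c x
      = (C *\<^sub>v (B *\<^sub>v (A *\<^sub>v x))) \<bullet>c (B *\<^sub>v (A *\<^sub>v x))"
    unfolding consecutive_def psd_mat_sandwich(2)[OF A BCB(1) x] by (rule BCB(2))
qed

text \<open>Summing over the last outcome is exact by completeness; each of the two earlier rounds
  loses only through the square of an effect lying below the effect.\<close>

lemma consecutive_sum_le_one:
  assumes M: "povm d R1 M1" "povm d R2 M2" "povm d R3 M3"
    and S: "finite R1" "finite R2" "finite R3" and x: "x \<in> carrier_vec d"
  shows "(\<Sum>a\<in>R1. \<Sum>b\<in>R2. \<Sum>c\<in>R3. Re ((consecutive (M1 a) (M2 b) (M3 c) *\<^sub>v x) \<bullet>c x)) \<le> Re (x \<bullet>c x)"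
proof -
  have psd: "\<And>a. a \<in> R1 \<Longrightarrow> psd_mat d (M1 a)" "\<And>a. a \<in> R2 \<Longrightarrow> psd_mat d (M2 a)"
    "\<And>a. a \<in> R3 \<Longrightarrow> psd_mat d (M3 a)"
    using M by (auto simp: povm_def)
  have post: "(\<Sum>a\<in>S. Re ((M a *\<^sub>v y) \<bullet>c (M a *\<^sub>v y))) \<le> Re (y \<bullet>c y)"
    if "povm d S M" "finite S" "y \<in> carrier_vec d" for S y and M :: "'e \<Rightarrow> complex mat"
    unfolding povm_complete[OF that(1,3), symmetric]
    by (intro sum_mono effect_sq_le[OF effect_povm[OF that(1,2)]] that(3))
  have "(\<Sum>a\<in>R1. \<Sum>b\<in>R2. \<Sum>c\<in>R3. Re ((consecutive (M1 a) (M2 b) (M3 c) *\<^sub>v x) \<bullet>c x))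
      = (\<Sum>a\<in>R1. \<Sum>b\<in>R2. Re ((M2 b *\<^sub>v (M1 a *\<^sub>v x)) \<bullet>c (M2 b *\<^sub>v (M1 a *\<^sub>v x))))"
  proof (intro sum.cong refl)
    fix a b assume ab: "a \<in> R1" "b \<in> R2"
    then have u: "M2 b *\<^sub>v (M1 a *\<^sub>v x) \<in> carrier_vec d"
      using psd_matD(1)[OF psd(1)] psd_matD(1)[OF psd(2)] x by (intro mult_mat_vec_carrier) auto
    show "(\<Sum>c\<in>R3. Re ((consecutive (M1 a) (M2 b) (M3 c) *\<^sub>v x) \<bullet>c x))
        = Re ((M2 b *\<^sub>v (M1 a *\<^sub>v x)) \<bullet>c (M2 b *\<^sub>v (M1 a *\<^sub>v x)))"
      unfolding povm_complete[OF M(3) u, symmetric]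
      using ab by (intro sum.cong refl) (simp add: consecutive(2)[OF psd x])
  qed
  also have "\<dots> \<le> (\<Sum>a\<in>R1. Re ((M1 a *\<^sub>v x) \<bullet>c (M1 a *\<^sub>v x)))"
    using psd_matD(1)[OF psd(1)] x by (intro sum_mono post M S mult_mat_vec_carrier) auto
  also have "\<dots> \<le> Re (x \<bullet>c x)" by (rule post[OF M(1) S(1) x])
  finally show ?thesis .
qed

text \<open>The coherent amplitude of winning three times is a sum over the winning answers; passing to
  fully read-out measurements costs the number of winning answers in the first two rounds.\<close>

lemma coherent_le_consecutive:
  assumes M: "povm d R1 M1" "povm d R2 M2" "povm d R3 M3"
    and V: "V1 \<subseteq> R1" "V2 \<subseteq> R2" "V3 \<subseteq> R3" and x: "x \<in> carrier_vec d"
    and T: "T = msum d V2 M2 *\<^sub>v (msum d V1 M1 *\<^sub>v x)"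
  shows "Re ((msum d V3 M3 *\<^sub>v T) \<bullet>c T) \<le> real (card V1) * real (card V2) *
    (\<Sum>a\<in>V1. \<Sum>b\<in>V2. \<Sum>c\<in>V3. Re ((consecutive (M1 a) (M2 b) (M3 c) *\<^sub>v x) \<bullet>c x))"
proof -
  have psd: "\<And>a. a \<in> V1 \<Longrightarrow> psd_mat d (M1 a)" "\<And>a. a \<in> V2 \<Longrightarrow> psd_mat d (M2 a)"
    "\<And>a. a \<in> V3 \<Longrightarrow> psd_mat d (M3 a)"
    using M V by (auto simp: povm_def)
  note car = psd[THEN psd_matD(1)]
  let ?W3 = "msum d V3 M3" and ?y = "msum d V1 M1 *\<^sub>v x"
  have W3: "psd_mat d ?W3" by (rule psd_mat_msum[OF psd(3)])
  have y: "?y \<in> carrier_vec d" using x by (intro mult_mat_vec_carrier[OF msum_carrier])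
  have "Re ((?W3 *\<^sub>v T) \<bullet>c T) \<le> real (card V2) * (\<Sum>b\<in>V2. Re ((?W3 *\<^sub>v (M2 b *\<^sub>v ?y)) \<bullet>c (M2 b *\<^sub>v ?y)))"
    unfolding T by (rule quad_msum_le[OF W3 car(2) y])
  also have "\<dots> \<le> real (card V2) * (\<Sum>b\<in>V2. real (card V1) *
      (\<Sum>a\<in>V1. \<Sum>c\<in>V3. Re ((consecutive (M1 a) (M2 b) (M3 c) *\<^sub>v x) \<bullet>c x)))"
  proof (intro mult_left_mono sum_mono of_nat_0_le_iff)
    fix b assume b: "b \<in> V2"
    let ?P = "M2 b * (?W3 * M2 b)"
    note P = psd_mat_sandwich[OF psd(2)[OF b] W3]
    have "Re ((?W3 *\<^sub>v (M2 b *\<^sub>v ?y)) \<bullet>c (M2 b *\<^sub>v ?y)) = Re ((?P *\<^sub>v ?y) \<bullet>c ?y)"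
      using P(2)[OF y] by simp
    also have "\<dots> \<le> real (card V1) * (\<Sum>a\<in>V1. Re ((?P *\<^sub>v (M1 a *\<^sub>v x)) \<bullet>c (M1 a *\<^sub>v x)))"
      by (rule quad_msum_le[OF P(1) car(1) x])
    also have "(\<Sum>a\<in>V1. Re ((?P *\<^sub>v (M1 a *\<^sub>v x)) \<bullet>c (M1 a *\<^sub>v x)))
        = (\<Sum>a\<in>V1. \<Sum>c\<in>V3. Re ((consecutive (M1 a) (M2 b) (M3 c) *\<^sub>v x) \<bullet>c x))"
    proof (intro sum.cong refl)
      fix a assume a: "a \<in> V1"
      let ?u = "M2 b *\<^sub>v (M1 a *\<^sub>v x)"
      have ax: "M1 a *\<^sub>v x \<in> carrier_vec d" using car(1)[OF a] x by auto
      have u: "?u \<in> carrier_vec d" using car(2)[OF b] ax by auto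
      \<comment> \<open>The last round enters the form linearly, so expanding it costs no factor
        \<open>card V3\<close>.\<close>
      have "(?P *\<^sub>v (M1 a *\<^sub>v x)) \<bullet>c (M1 a *\<^sub>v x) = (\<Sum>c\<in>V3. (M3 c *\<^sub>v ?u) \<bullet>c ?u)"
        unfolding P(2)[OF ax] by (rule msum_cscalar[OF car(3) u u])
      then show "Re ((?P *\<^sub>v (M1 a *\<^sub>v x)) \<bullet>c (M1 a *\<^sub>v x))
          = (\<Sum>c\<in>V3. Re ((consecutive (M1 a) (M2 b) (M3 c) *\<^sub>v x) \<bullet>c x))"
        using a b by (simp add: consecutive(2)[OF psd x])
    qed
    finally show "Re ((?W3 *\<^sub>v (M2 b *\<^sub>v ?y)) \<bullet>c (M2 b *\<^sub>v ?y)) \<le> real (card V1) *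
      (\<Sum>a\<in>V1. \<Sum>c\<in>V3. Re ((consecutive (M1 a) (M2 b) (M3 c) *\<^sub>v x) \<bullet>c x))" .
  qed
  also have "\<dots> = real (card V1) * real (card V2) *
    (\<Sum>a\<in>V1. \<Sum>b\<in>V2. \<Sum>c\<in>V3. Re ((consecutive (M1 a) (M2 b) (M3 c) *\<^sub>v x) \<bullet>c x))"
    by (subst (2) sum.swap) (simp add: sum_distrib_left[symmetric] ac_simps)
  finally show ?thesis .
qed

section \<open>Bipartite states\<close>

text \<open>Splits a flat index into the pair of indices used by \<open>kron\<close>.\<close>

lemma sum_lessThan_mult:
  fixes f :: "nat \<Rightarrow> 'a::comm_monoid_add"
  shows "(\<Sum>i<m * n. f i) = (\<Sum>e<m. \<Sum>q<n. f (e * n + q))"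
proof -
  have "sum f {e * n..<e * n + n} = (\<Sum>q<n. f (e * n + q))" for e
    using sum.shift_bounds_nat_ivl[of f 0 "e * n" n] by (simp add: ac_simps atLeast0LessThan)
  then show ?thesis using sum.nat_group[of f n m] by simp
qed

lemma mat_trace_kron:
  assumes "\<rho> \<in> carrier_mat (dA * dB) (dA * dB)" "A \<in> carrier_mat dA dA" "X \<in> carrier_mat dB dB"
  shows "mat_trace (\<rho> * kron A X) = (\<Sum>i<dA * dB. \<Sum>j<dA * dB.
    \<rho> $$ (i, j) * (A $$ (j div dB, i div dB) * X $$ (j mod dB, i mod dB)))"
  using assms
  by (simp add: mat_trace_def kron_def scalar_prod_def row_def col_def lessThan_atLeast0)

text \<open>No signalling: Bob's statistics, averaged over Alice's outcomes, do not depend on her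
  measurement, because her effects sum to the identity.\<close>

lemma mat_trace_kron_povm:
  assumes \<rho>: "\<rho> \<in> carrier_mat (dA * dB) (dA * dB)" and X: "X \<in> carrier_mat dB dB"
    and A: "povm dA S A"
  shows "(\<Sum>a\<in>S. mat_trace (\<rho> * kron (A a) X)) = mat_trace (\<rho> * kron (1\<^sub>m dA) X)"
proof -
  have Ac: "A a \<in> carrier_mat dA dA" if "a \<in> S" for a
    using A that by (auto simp: povm_def psd_mat_def)
  have entry: "(\<Sum>a\<in>S. A a $$ (i, j)) = 1\<^sub>m dA $$ (i, j)" if "i < dA" "j < dA" for i j
  proof -
    have "mat dA dA (\<lambda>ij. \<Sum>a\<in>S. A a $$ ij) $$ (i, j) = 1\<^sub>m dA $$ (i, j)"
      using A by (simp only: povm_def)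
    then show ?thesis using that by simp
  qed
  have "(\<Sum>a\<in>S. mat_trace (\<rho> * kron (A a) X)) = (\<Sum>a\<in>S. \<Sum>i<dA * dB. \<Sum>j<dA * dB.
    \<rho> $$ (i, j) * (A a $$ (j div dB, i div dB) * X $$ (j mod dB, i mod dB)))"
    by (intro sum.cong refl mat_trace_kron \<rho> Ac X)
  also have "\<dots> = (\<Sum>i<dA * dB. \<Sum>j<dA * dB. \<Sum>a\<in>S.
    \<rho> $$ (i, j) * (A a $$ (j div dB, i div dB) * X $$ (j mod dB, i mod dB)))"
    by (subst sum.swap, intro sum.cong refl, rule sum.swap)
  also have "\<dots> = (\<Sum>i<dA * dB. \<Sum>j<dA * dB.
    \<rho> $$ (i, j) * (1\<^sub>m dA $$ (j div dB, i div dB) * X $$ (j mod dB, i mod dB)))"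
    by (intro sum.cong refl)
      (simp add: sum_distrib_left[symmetric] sum_distrib_right[symmetric] entry less_mult_imp_div_less)
  also have "\<dots> = mat_trace (\<rho> * kron (1\<^sub>m dA) X)"
    by (rule mat_trace_kron[symmetric, OF \<rho> _ X]) simp
  finally show ?thesis .
qed

lemma mat_trace_kron_one:
  assumes "\<rho> \<in> carrier_mat (dA * dB) (dA * dB)"
  shows "mat_trace (\<rho> * kron (1\<^sub>m dA) (1\<^sub>m dB)) = mat_trace \<rho>"
proof -
  have "kron (1\<^sub>m dA) (1\<^sub>m dB) = 1\<^sub>m (dA * dB)"
  proof (rule eq_matI)
    fix i j assume ij: "i < dim_row (1\<^sub>m (dA * dB))" "j < dim_col (1\<^sub>m (dA * dB))"
    then have "dB > 0" by (cases dB) auto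
    moreover have "i = j" if "i div dB = j div dB" "i mod dB = j mod dB"
      using that by (metis div_mult_mod_eq)
    ultimately show "kron (1\<^sub>m dA) (1\<^sub>m dB) $$ (i, j) = (1\<^sub>m (dA * dB) $$ (i, j) :: complex)"
      using ij by (auto simp: kron_def less_mult_imp_div_less)
  qed (auto simp: kron_def)
  then show ?thesis using assms by simp
qed

text \<open>Measuring \<open>A\<close> on one half of the state steers the other half to an unnormalised mixture of
  vectors.\<close>

lemma steered_state:
  assumes \<rho>: "psd_mat (dA * dB) \<rho>" and A: "psd_mat dA A"
  obtains J :: "(nat \<times> nat) set" and \<psi> where "\<And>j. \<psi> j \<in> carrier_vec dB"
    and "\<And>X. X \<in> carrier_mat dB dB \<Longrightarrow>
      mat_trace (\<rho> * kron A X) = (\<Sum>j\<in>J. (X *\<^sub>v \<psi> j) \<bullet>c \<psi> j)"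
proof -
  let ?n = "dA * dB"
  obtain R where R: "\<And>i j. i < ?n \<Longrightarrow> j < ?n \<Longrightarrow> \<rho> $$ (i, j) = (\<Sum>l<?n. R l i * cnj (R l j))"
    using psd_mat_decomposition[OF \<rho>] by blast
  obtain U where U: "\<And>i j. i < dA \<Longrightarrow> j < dA \<Longrightarrow> A $$ (i, j) = (\<Sum>m<dA. U m i * cnj (U m j))"
    using psd_mat_decomposition[OF A] by blast
  \<comment> \<open>With \<open>\<rho>\<close> and \<open>A\<close> written as sums of rank-one
    matrices of the vectors \<open>R l\<close> and \<open>U m\<close>, contracting Alice's index of
    \<open>R l\<close> with the conjugate of \<open>U m\<close> leaves one vector of Bob's for every
    pair \<open>(l, m)\<close>.\<close>
  define \<phi> where "\<phi> l m = vec dB (\<lambda>q. \<Sum>e<dA. cnj (U m e) * R l (e * dB + q))" for l m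
  have \<phi>: "\<phi> l m \<in> carrier_vec dB" for l m by (simp add: \<phi>_def)
  show thesis
  proof (rule that[of "\<lambda>j. \<phi> (fst j) (snd j)" "{..<?n} \<times> {..<dA}", OF \<phi>])
    fix X :: "complex mat" assume X: "X \<in> carrier_mat dB dB"
    let ?t = "\<lambda>l m i j. R l i * cnj (R l j) * (U m (j div dB) * cnj (U m (i div dB))) * X $$ (j mod dB, i mod dB)"
    have "mat_trace (\<rho> * kron A X) = (\<Sum>i<?n. \<Sum>j<?n. \<Sum>l<?n. \<Sum>m<dA. ?t l m i j)"
      unfolding mat_trace_kron[OF psd_matD(1)[OF \<rho>] psd_matD(1)[OF A] X]
    proof (intro sum.cong refl)
      fix i j assume "i \<in> {..<?n}" "j \<in> {..<?n}"
      then have "\<rho> $$ (i, j) * A $$ (j div dB, i div dB) = (\<Sum>l<?n. \<Sum>m<dA.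
          R l i * cnj (R l j) * (U m (j div dB) * cnj (U m (i div dB))))"
        by (simp add: R U less_mult_imp_div_less sum_product)
      then show "\<rho> $$ (i, j) * (A $$ (j div dB, i div dB) * X $$ (j mod dB, i mod dB))
          = (\<Sum>l<?n. \<Sum>m<dA. ?t l m i j)"
        by (simp add: sum_distrib_right mult.assoc[symmetric])
    qed
    also have "\<dots> = (\<Sum>i<?n. \<Sum>l<?n. \<Sum>j<?n. \<Sum>m<dA. ?t l m i j)"
      by (intro sum.cong refl sum.swap)
    also have "\<dots> = (\<Sum>l<?n. \<Sum>i<?n. \<Sum>j<?n. \<Sum>m<dA. ?t l m i j)"
      by (rule sum.swap)
    also have "\<dots> = (\<Sum>l<?n. \<Sum>i<?n. \<Sum>m<dA. \<Sum>j<?n. ?t l m i j)"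
      by (intro sum.cong refl sum.swap)
    also have "\<dots> = (\<Sum>l<?n. \<Sum>m<dA. \<Sum>i<?n. \<Sum>j<?n. ?t l m i j)"
      by (intro sum.cong refl sum.swap)
    also have "\<dots> = (\<Sum>l<?n. \<Sum>m<dA. (X *\<^sub>v \<phi> l m) \<bullet>c \<phi> l m)"
    proof (intro sum.cong refl)
      fix l m
      let ?u = "\<lambda>e q. cnj (U m e) * R l (e * dB + q)"
      let ?s = "\<lambda>e q g p. X $$ (p, q) * (?u e q * cnj (?u g p))"
      have "(\<Sum>i<?n. \<Sum>j<?n. ?t l m i j) = (\<Sum>e<dA. \<Sum>q<dB. \<Sum>g<dA. \<Sum>p<dB. ?s e q g p)"
        unfolding sum_lessThan_mult by (intro sum.cong refl) (simp add: ac_simps)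
      also have "\<dots> = (\<Sum>q<dB. \<Sum>e<dA. \<Sum>g<dA. \<Sum>p<dB. ?s e q g p)"
        by (rule sum.swap)
      also have "\<dots> = (\<Sum>q<dB. \<Sum>e<dA. \<Sum>p<dB. \<Sum>g<dA. ?s e q g p)"
        by (intro sum.cong refl sum.swap)
      also have "\<dots> = (\<Sum>q<dB. \<Sum>p<dB. \<Sum>e<dA. \<Sum>g<dA. ?s e q g p)"
        by (intro sum.cong refl sum.swap)
      also have "\<dots> = (\<Sum>p<dB. \<Sum>q<dB. \<Sum>e<dA. \<Sum>g<dA. ?s e q g p)"
        by (rule sum.swap)
      also have "\<dots> = (\<Sum>p<dB. \<Sum>q<dB. X $$ (p, q) * \<phi> l m $ q * cnj (\<phi> l m $ p))"
      proof (intro sum.cong refl)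
        fix p q assume "p \<in> {..<dB}" "q \<in> {..<dB}"
        then have "X $$ (p, q) * \<phi> l m $ q * cnj (\<phi> l m $ p)
            = X $$ (p, q) * ((\<Sum>e<dA. ?u e q) * (\<Sum>g<dA. cnj (?u g p)))"
          by (simp add: \<phi>_def cnj_sum)
        moreover have "(\<Sum>e<dA. \<Sum>g<dA. ?s e q g p)
            = X $$ (p, q) * ((\<Sum>e<dA. ?u e q) * (\<Sum>g<dA. cnj (?u g p)))"
          by (subst sum_product) (simp only: sum_distrib_left)
        ultimately show "(\<Sum>e<dA. \<Sum>g<dA. ?s e q g p) = X $$ (p, q) * \<phi> l m $ q * cnj (\<phi> l m $ p)"
          by argo
      qed
      also have "\<dots> = (X *\<^sub>v \<phi> l m) \<bullet>c \<phi> l m"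
        by (rule cscalar_mult_mat_vec[OF X \<phi> \<phi>, symmetric])
      finally show "(\<Sum>i<?n. \<Sum>j<?n. ?t l m i j) = (X *\<^sub>v \<phi> l m) \<bullet>c \<phi> l m" .
    qed
    finally show "mat_trace (\<rho> * kron A X)
        = (\<Sum>j\<in>{..<?n} \<times> {..<dA}. (X *\<^sub>v \<phi> (fst j) (snd j)) \<bullet>c \<phi> (fst j) (snd j))"
      by (simp only: sum.cartesian_product case_prod_unfold)
  qed
qed

lemma mat_trace_kron_nonneg:
  assumes "psd_mat (dA * dB) \<rho>" "psd_mat dA A" "psd_mat dB X"
  shows "0 \<le> Re (mat_trace (\<rho> * kron A X))"
proof -
  obtain J :: "(nat \<times> nat) set" and \<psi> where \<psi>: "\<And>j. \<psi> j \<in> carrier_vec dB"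
    and state: "\<And>X. X \<in> carrier_mat dB dB \<Longrightarrow>
      mat_trace (\<rho> * kron A X) = (\<Sum>j\<in>J. (X *\<^sub>v \<psi> j) \<bullet>c \<psi> j)"
    by (rule steered_state[OF assms(1,2)]) (rule that)
  show ?thesis
    unfolding state[OF psd_matD(1)[OF assms(3)]] Re_sum
    by (intro sum_nonneg psd_mat_Re_nonneg[OF assms(3)] \<psi>)
qed

section \<open>From single vectors to the shared state\<close>

abbreviation read_out ::
  "('a \<Rightarrow> complex mat) \<Rightarrow> ('b \<Rightarrow> complex mat) \<Rightarrow> ('c \<Rightarrow> complex mat) \<Rightarrow> 'a \<times> 'b \<times> 'c \<Rightarrow> complex mat" where
  "read_out M1 M2 M3 t \<equiv> consecutive (M1 (fst t)) (M2 (fst (snd t))) (M3 (snd (snd t)))"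

context
  fixes dA dB :: nat and \<rho> A :: "complex mat"
    and R1 :: "'a set" and R2 :: "'b set" and R3 :: "'c set"
    and M1 :: "'a \<Rightarrow> complex mat" and M2 :: "'b \<Rightarrow> complex mat" and M3 :: "'c \<Rightarrow> complex mat"
  assumes \<rho>: "psd_mat (dA * dB) \<rho>" and A: "psd_mat dA A"
    and M: "povm dB R1 M1" "povm dB R2 M2" "povm dB R3 M3"
    and fin: "finite R1" "finite R2" "finite R3"
begin

text \<open>For fixed \<open>l\<close> the estimate for one vector is linear in the quadratic forms,
  so it can be summed over the steered mixture, where the forms become traces.\<close>

lemma steered_three_wins:
  assumes V: "V1 \<subseteq> R1" "V2 \<subseteq> R2" "V3 \<subseteq> R3" and l: "0 < l"
  shows "(\<Sum>a\<in>V1. Re (mat_trace (\<rho> * kron A (M1 a)))) + (\<Sum>b\<in>V2. Re (mat_trace (\<rho> * kron A (M2 b))))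
      + (\<Sum>c\<in>V3. Re (mat_trace (\<rho> * kron A (M3 c))))
    \<le> (2 + 3 / 4 * l) * Re (mat_trace (\<rho> * kron A (1\<^sub>m dB)))
      + real (card V1) * real (card V2) / l ^ 3 *
        (\<Sum>t\<in>V1 \<times> V2 \<times> V3. Re (mat_trace (\<rho> * kron A (read_out M1 M2 M3 t))))"
proof -
  obtain J :: "(nat \<times> nat) set" and \<psi> where \<psi>: "\<And>j. \<psi> j \<in> carrier_vec dB"
    and state: "\<And>X. X \<in> carrier_mat dB dB \<Longrightarrow>
      mat_trace (\<rho> * kron A X) = (\<Sum>j\<in>J. (X *\<^sub>v \<psi> j) \<bullet>c \<psi> j)"
    by (rule steered_state[OF \<rho> A]) (rule that)
  have psd: "\<And>a. a \<in> V1 \<Longrightarrow> psd_mat dB (M1 a)" "\<And>a. a \<in> V2 \<Longrightarrow> psd_mat dB (M2 a)"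
    "\<And>a. a \<in> V3 \<Longrightarrow> psd_mat dB (M3 a)"
    using M V by (auto simp: povm_def)
  have tr: "Re (mat_trace (\<rho> * kron A X)) = (\<Sum>j\<in>J. Re ((X *\<^sub>v \<psi> j) \<bullet>c \<psi> j))"
    if "X \<in> carrier_mat dB dB" for X
    by (simp add: state[OF that])
  have trsum: "(\<Sum>a\<in>V. Re (mat_trace (\<rho> * kron A (N a)))) = (\<Sum>j\<in>J. Re ((msum dB V N *\<^sub>v \<psi> j) \<bullet>c \<psi> j))"
    if N: "\<And>a. a \<in> V \<Longrightarrow> psd_mat dB (N a)" for V :: "'e set" and N
  proof -
    have "(\<Sum>a\<in>V. Re (mat_trace (\<rho> * kron A (N a)))) = (\<Sum>a\<in>V. \<Sum>j\<in>J. Re ((N a *\<^sub>v \<psi> j) \<bullet>c \<psi> j))"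
      by (intro sum.cong refl tr psd_matD(1)[OF N])
    also have "\<dots> = (\<Sum>j\<in>J. \<Sum>a\<in>V. Re ((N a *\<^sub>v \<psi> j) \<bullet>c \<psi> j))" by (rule sum.swap)
    also have "\<dots> = (\<Sum>j\<in>J. Re ((msum dB V N *\<^sub>v \<psi> j) \<bullet>c \<psi> j))"
      using msum_cscalar[of V N dB, OF psd_matD(1)[OF N] \<psi> \<psi>] by simp
    finally show ?thesis .
  qed
  let ?W1 = "msum dB V1 M1" and ?W2 = "msum dB V2 M2" and ?W3 = "msum dB V3 M3"
  let ?K = "real (card V1) * real (card V2)"
  let ?C = "\<lambda>j. \<Sum>t\<in>V1 \<times> V2 \<times> V3. Re ((read_out M1 M2 M3 t *\<^sub>v \<psi> j) \<bullet>c \<psi> j)"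
  have "Re ((?W1 *\<^sub>v \<psi> j) \<bullet>c \<psi> j) + Re ((?W2 *\<^sub>v \<psi> j) \<bullet>c \<psi> j) + Re ((?W3 *\<^sub>v \<psi> j) \<bullet>c \<psi> j)
      \<le> (2 + 3 / 4 * l) * Re ((1\<^sub>m dB *\<^sub>v \<psi> j) \<bullet>c \<psi> j) + ?K / l ^ 3 * ?C j" for j
  proof -
    let ?T = "?W2 *\<^sub>v (?W1 *\<^sub>v \<psi> j)"
    have "Re ((?W3 *\<^sub>v ?T) \<bullet>c ?T) \<le> ?K *
        (\<Sum>a\<in>V1. \<Sum>b\<in>V2. \<Sum>c\<in>V3. Re ((consecutive (M1 a) (M2 b) (M3 c) *\<^sub>v \<psi> j) \<bullet>c \<psi> j))"
      by (rule coherent_le_consecutive[OF M V \<psi> refl])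
    also have "\<dots> = ?K * ?C j"
      by (simp add: sum.cartesian_product case_prod_unfold)
    finally have "Re ((?W3 *\<^sub>v ?T) \<bullet>c ?T) / l ^ 3 \<le> ?K * ?C j / l ^ 3"
      using l by (intro divide_right_mono) auto
    moreover note three_effects[OF effect_msum[OF M(1) fin(1) V(1)] effect_msum[OF M(2) fin(2) V(2)]
        effect_msum[OF M(3) fin(3) V(3)] \<psi> refl refl l, of j]
    moreover have "1\<^sub>m dB *\<^sub>v \<psi> j = \<psi> j" using \<psi> by simp
    ultimately show ?thesis by (simp add: distrib_right)
  qed
  then have "(\<Sum>j\<in>J. Re ((?W1 *\<^sub>v \<psi> j) \<bullet>c \<psi> j) + Re ((?W2 *\<^sub>v \<psi> j) \<bullet>c \<psi> j) + Re ((?W3 *\<^sub>v \<psi> j) \<bullet>c \<psi> j))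
      \<le> (\<Sum>j\<in>J. (2 + 3 / 4 * l) * Re ((1\<^sub>m dB *\<^sub>v \<psi> j) \<bullet>c \<psi> j) + ?K / l ^ 3 * ?C j)"
    by (rule sum_mono)
  also have "\<dots> = (2 + 3 / 4 * l) * Re (mat_trace (\<rho> * kron A (1\<^sub>m dB))) + ?K / l ^ 3 * (\<Sum>j\<in>J. ?C j)"
    by (simp only: sum.distrib sum_distrib_left tr[OF one_carrier_mat])
  also have "(\<Sum>j\<in>J. ?C j) = (\<Sum>t\<in>V1 \<times> V2 \<times> V3. \<Sum>j\<in>J. Re ((read_out M1 M2 M3 t *\<^sub>v \<psi> j) \<bullet>c \<psi> j))"
    by (rule sum.swap)
  also have "\<dots> = (\<Sum>t\<in>V1 \<times> V2 \<times> V3. Re (mat_trace (\<rho> * kron A (read_out M1 M2 M3 t))))"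
    by (intro sum.cong refl tr[symmetric] psd_matD(1)[OF consecutive(1)] psd) auto
  finally show ?thesis
    by (simp only: sum.distrib trsum[of V1 M1, OF psd(1)] trsum[of V2 M2, OF psd(2)] trsum[of V3 M3, OF psd(3)])
qed

text \<open>The bound on the total weight of consecutive outcomes, summed over the steered
  mixture.\<close>

lemma steered_read_out_le:
  "(\<Sum>t\<in>R1 \<times> R2 \<times> R3. Re (mat_trace (\<rho> * kron A (read_out M1 M2 M3 t))))
    \<le> Re (mat_trace (\<rho> * kron A (1\<^sub>m dB)))"
proof -
  obtain J :: "(nat \<times> nat) set" and \<psi> where \<psi>: "\<And>j. \<psi> j \<in> carrier_vec dB"
    and state: "\<And>X. X \<in> carrier_mat dB dB \<Longrightarrow>
      mat_trace (\<rho> * kron A X) = (\<Sum>j\<in>J. (X *\<^sub>v \<psi> j) \<bullet>c \<psi> j)"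
    by (rule steered_state[OF \<rho> A]) (rule that)
  have psd: "\<And>a. a \<in> R1 \<Longrightarrow> psd_mat dB (M1 a)" "\<And>a. a \<in> R2 \<Longrightarrow> psd_mat dB (M2 a)"
    "\<And>a. a \<in> R3 \<Longrightarrow> psd_mat dB (M3 a)"
    using M by (auto simp: povm_def)
  have tr: "Re (mat_trace (\<rho> * kron A X)) = (\<Sum>j\<in>J. Re ((X *\<^sub>v \<psi> j) \<bullet>c \<psi> j))"
    if "X \<in> carrier_mat dB dB" for X
    by (simp add: state[OF that])
  have "(\<Sum>t\<in>R1 \<times> R2 \<times> R3. Re (mat_trace (\<rho> * kron A (read_out M1 M2 M3 t))))
      = (\<Sum>t\<in>R1 \<times> R2 \<times> R3. \<Sum>j\<in>J. Re ((read_out M1 M2 M3 t *\<^sub>v \<psi> j) \<bullet>c \<psi> j))"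
    by (intro sum.cong refl tr psd_matD(1)[OF consecutive(1)] psd) auto
  also have "\<dots> = (\<Sum>j\<in>J. \<Sum>t\<in>R1 \<times> R2 \<times> R3. Re ((read_out M1 M2 M3 t *\<^sub>v \<psi> j) \<bullet>c \<psi> j))"
    by (rule sum.swap)
  also have "\<dots> \<le> (\<Sum>j\<in>J. Re ((1\<^sub>m dB *\<^sub>v \<psi> j) \<bullet>c \<psi> j))"
  proof (rule sum_mono)
    fix j
    have "(\<Sum>t\<in>R1 \<times> R2 \<times> R3. Re ((read_out M1 M2 M3 t *\<^sub>v \<psi> j) \<bullet>c \<psi> j))
        = (\<Sum>a\<in>R1. \<Sum>b\<in>R2. \<Sum>c\<in>R3. Re ((consecutive (M1 a) (M2 b) (M3 c) *\<^sub>v \<psi> j) \<bullet>c \<psi> j))"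
      by (simp add: sum.cartesian_product case_prod_unfold)
    also have "\<dots> \<le> Re (\<psi> j \<bullet>c \<psi> j)" by (rule consecutive_sum_le_one[OF M fin \<psi>])
    finally show "(\<Sum>t\<in>R1 \<times> R2 \<times> R3. Re ((read_out M1 M2 M3 t *\<^sub>v \<psi> j) \<bullet>c \<psi> j))
        \<le> Re ((1\<^sub>m dB *\<^sub>v \<psi> j) \<bullet>c \<psi> j)" using \<psi> by simp
  qed
  also have "\<dots> = Re (mat_trace (\<rho> * kron A (1\<^sub>m dB)))" by (rule tr[symmetric]) simp
  finally show ?thesis .
qed

end

text \<open>Here \<open>x\<close> and \<open>y\<close> are Alice's question and answer, and
  \<open>V1\<close>, \<open>V2\<close>, \<open>V3\<close> are Bob's winning answers. A triple read
  out by Bob wins all three challenges for at most \<open>g\<close> questions, while its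
  distribution does not depend on the question; this bounds the error term.\<close>

lemma three_challenge_bound:
  fixes V1 :: "'x \<Rightarrow> 'y \<Rightarrow> 'a set" and V2 :: "'x \<Rightarrow> 'y \<Rightarrow> 'b set" and V3 :: "'x \<Rightarrow> 'y \<Rightarrow> 'c set"
  assumes \<rho>: "density_mat (dA * dB) \<rho>"
    and A: "\<And>x. x \<in> X \<Longrightarrow> povm dA (Y x) (A x)" and X: "finite X"
    and M: "povm dB R1 M1" "povm dB R2 M2" "povm dB R3 M3"
    and fin: "finite R1" "finite R2" "finite R3"
    and V: "\<And>x y. V1 x y \<subseteq> R1" "\<And>x y. V2 x y \<subseteq> R2" "\<And>x y. V3 x y \<subseteq> R3"
    and K: "\<And>x y. card (V1 x y) \<le> K1" "\<And>x y. card (V2 x y) \<le> K2"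
    and guess: "\<And>a b c. a \<in> R1 \<Longrightarrow> b \<in> R2 \<Longrightarrow> c \<in> R3 \<Longrightarrow>
      card {x \<in> X. \<exists>y \<in> Y x. a \<in> V1 x y \<and> b \<in> V2 x y \<and> c \<in> V3 x y} \<le> g"
    and l: "0 < l"
  shows "(\<Sum>x\<in>X. \<Sum>y\<in>Y x. (\<Sum>a\<in>V1 x y. Re (mat_trace (\<rho> * kron (A x y) (M1 a))))
      + (\<Sum>b\<in>V2 x y. Re (mat_trace (\<rho> * kron (A x y) (M2 b))))
      + (\<Sum>c\<in>V3 x y. Re (mat_trace (\<rho> * kron (A x y) (M3 c)))))
    \<le> (2 + 3 / 4 * l) * real (card X) + real K1 * real K2 * real g / l ^ 3"
proof -
  have psd\<rho>: "psd_mat (dA * dB) \<rho>" and tr\<rho>: "mat_trace \<rho> = 1"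
    using \<rho> by (auto simp: density_mat_def)
  note \<rho>c = psd_matD(1)[OF psd\<rho>]
  let ?f = "\<lambda>x y Z. Re (mat_trace (\<rho> * kron (A x y) Z))"
  let ?h = "\<lambda>Z. Re (mat_trace (\<rho> * kron (1\<^sub>m dA) Z))"
  let ?R = "R1 \<times> R2 \<times> R3"
  let ?V = "\<lambda>x y. V1 x y \<times> V2 x y \<times> V3 x y"
  let ?C = "read_out M1 M2 M3"
  let ?E = "\<lambda>t. {x \<in> X. \<exists>y \<in> Y x. t \<in> ?V x y}"
  have C: "psd_mat dB (?C t)" if "t \<in> ?R" for t
    using M that by (intro consecutive(1)) (auto simp: povm_def)
  have Apsd: "psd_mat dA (A x y)" if "x \<in> X" "y \<in> Y x" for x y
    using A[OF that(1)] that(2) by (simp add: povm_def)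
  have steer: "(\<Sum>y\<in>Y x. ?f x y Z) = ?h Z" if "x \<in> X" "Z \<in> carrier_mat dB dB" for x Z
    unfolding Re_sum[symmetric] mat_trace_kron_povm[OF \<rho>c that(2) A[OF that(1)]] ..
  have one: "?h (1\<^sub>m dB) = 1" using mat_trace_kron_one[OF \<rho>c] tr\<rho> by simp
  have finR: "finite ?R" using fin by simp
  have "(\<Sum>a\<in>V1 x y. ?f x y (M1 a)) + (\<Sum>b\<in>V2 x y. ?f x y (M2 b)) + (\<Sum>c\<in>V3 x y. ?f x y (M3 c))
      \<le> (2 + 3 / 4 * l) * ?f x y (1\<^sub>m dB)
        + real K1 * real K2 / l ^ 3 * (\<Sum>t\<in>?R. if x \<in> ?E t then ?f x y (?C t) else 0)"
    if xy: "x \<in> X" "y \<in> Y x" for x y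
  proof -
    have pos: "0 \<le> ?f x y (?C t)" if "t \<in> ?R" for t
      by (rule mat_trace_kron_nonneg[OF psd\<rho> Apsd[OF xy] C[OF that]])
    have VR: "?V x y \<subseteq> ?R" using V by blast
    have "(\<Sum>t\<in>?V x y. ?f x y (?C t)) = (\<Sum>t\<in>?R. if t \<in> ?V x y then ?f x y (?C t) else 0)"
      using VR finR by (simp add: sum.If_cases Int_absorb1)
    \<comment> \<open>Winning with this \<open>y\<close> is relaxed to winning with some
      \<open>y\<close>. The new condition is free of \<open>y\<close>, so that the sum over Alice's
      answers can be carried out.\<close>
    also have "\<dots> \<le> (\<Sum>t\<in>?R. if x \<in> ?E t then ?f x y (?C t) else 0)"
      using pos xy by (intro sum_mono) auto
    finally have "(\<Sum>t\<in>?V x y. ?f x y (?C t)) \<le> (\<Sum>t\<in>?R. if x \<in> ?E t then ?f x y (?C t) else 0)" .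
    moreover have "real (card (V1 x y)) * real (card (V2 x y)) / l ^ 3 \<le> real K1 * real K2 / l ^ 3"
      using K l by (intro divide_right_mono mult_mono) auto
    moreover have "0 \<le> (\<Sum>t\<in>?V x y. ?f x y (?C t))" using pos VR by (intro sum_nonneg) blast
    ultimately have "real (card (V1 x y)) * real (card (V2 x y)) / l ^ 3 * (\<Sum>t\<in>?V x y. ?f x y (?C t))
        \<le> real K1 * real K2 / l ^ 3 * (\<Sum>t\<in>?R. if x \<in> ?E t then ?f x y (?C t) else 0)"
      using l by (intro mult_mono) auto
    then show ?thesis
      using steered_three_wins[OF psd\<rho> Apsd[OF xy] M fin V l, of x y x y x y] by linarith
  qed
  then have "(\<Sum>x\<in>X. \<Sum>y\<in>Y x. (\<Sum>a\<in>V1 x y. ?f x y (M1 a)) + (\<Sum>b\<in>V2 x y. ?f x y (M2 b))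
        + (\<Sum>c\<in>V3 x y. ?f x y (M3 c)))
      \<le> (\<Sum>x\<in>X. \<Sum>y\<in>Y x. (2 + 3 / 4 * l) * ?f x y (1\<^sub>m dB)
        + real K1 * real K2 / l ^ 3 * (\<Sum>t\<in>?R. if x \<in> ?E t then ?f x y (?C t) else 0))"
    by (intro sum_mono) auto
  \<comment> \<open>No signalling replaces the sum over Alice's answers by her identity, for both
    terms.\<close>
  also have "\<dots> = (\<Sum>x\<in>X. (2 + 3 / 4 * l) + real K1 * real K2 / l ^ 3 * (\<Sum>t\<in>?R. if x \<in> ?E t then ?h (?C t) else 0))"
  proof (rule sum.cong[OF refl])
    fix x assume x: "x \<in> X"
    have "(\<Sum>y\<in>Y x. \<Sum>t\<in>?R. if x \<in> ?E t then ?f x y (?C t) else 0)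
        = (\<Sum>t\<in>?R. \<Sum>y\<in>Y x. if x \<in> ?E t then ?f x y (?C t) else 0)"
      by (rule sum.swap)
    also have "\<dots> = (\<Sum>t\<in>?R. if x \<in> ?E t then ?h (?C t) else 0)"
    proof (rule sum.cong[OF refl])
      fix t assume "t \<in> ?R"
      then show "(\<Sum>y\<in>Y x. if x \<in> ?E t then ?f x y (?C t) else 0) = (if x \<in> ?E t then ?h (?C t) else 0)"
        using steer[OF x psd_matD(1)[OF C]] by (cases "x \<in> ?E t") (simp_all only: if_True if_False sum.neutral_const)
    qed
    finally show "(\<Sum>y\<in>Y x. (2 + 3 / 4 * l) * ?f x y (1\<^sub>m dB)
        + real K1 * real K2 / l ^ 3 * (\<Sum>t\<in>?R. if x \<in> ?E t then ?f x y (?C t) else 0))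
        = (2 + 3 / 4 * l) + real K1 * real K2 / l ^ 3 * (\<Sum>t\<in>?R. if x \<in> ?E t then ?h (?C t) else 0)"
      using steer[OF x one_carrier_mat] one
      by (simp only: sum.distrib sum_distrib_left[symmetric] mult_1_right)
  qed
  also have "\<dots> = (2 + 3 / 4 * l) * real (card X) + real K1 * real K2 / l ^ 3 *
      (\<Sum>t\<in>?R. \<Sum>x\<in>X. if x \<in> ?E t then ?h (?C t) else 0)"
    unfolding sum.distrib sum_distrib_left[symmetric]
    by (subst sum.swap) (simp add: algebra_simps)
  also have "\<dots> \<le> (2 + 3 / 4 * l) * real (card X) + real K1 * real K2 / l ^ 3 * (\<Sum>t\<in>?R. real g * ?h (?C t))"
  proof (intro add_left_mono mult_left_mono sum_mono)
    fix t assume t: "t \<in> ?R"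
    have "(\<Sum>x\<in>X. if x \<in> ?E t then ?h (?C t) else 0) = real (card (?E t)) * ?h (?C t)"
      using X by (simp add: sum.If_cases Int_def cong: conj_cong)
    also have "\<dots> \<le> real g * ?h (?C t)"
      using guess[of "fst t" "fst (snd t)" "snd (snd t)"] t
        mat_trace_kron_nonneg[OF psd\<rho> psd_mat_one C[OF t]]
      by (intro mult_right_mono) (auto simp: mem_Times_iff)
    finally show "(\<Sum>x\<in>X. if x \<in> ?E t then ?h (?C t) else 0) \<le> real g * ?h (?C t)" .
  qed (use l in simp)
  also have "(\<Sum>t\<in>?R. real g * ?h (?C t)) = real g * (\<Sum>t\<in>?R. ?h (?C t))"
    by (rule sum_distrib_left[symmetric])
  \<comment> \<open>The read-out triples have total weight at most \<open>1\<close>.\<close>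
  also have "(2 + 3 / 4 * l) * real (card X) + real K1 * real K2 / l ^ 3 * (real g * (\<Sum>t\<in>?R. ?h (?C t)))
      \<le> (2 + 3 / 4 * l) * real (card X) + real K1 * real K2 / l ^ 3 * (real g * 1)"
    using steered_read_out_le[OF psd\<rho> psd_mat_one M fin] one l
    by (intro add_left_mono mult_left_mono) simp_all
  finally show ?thesis by simp
qed

section \<open>The relativistic Stern game\<close>

text \<open>Decodable elements have an index below \<open>N\<close> in the enumeration
  \<open>fe\<close>.\<close>

lemma card_decodable_le:
  assumes fe: "bij_betw fe {..<CARD('f::finite)} (UNIV :: 'f set)"
  shows "card {z :: 'f. decode fe N e z \<noteq> None} \<le> N"
proof -
  have "{z :: 'f. decode fe N e z \<noteq> None} \<subseteq> fe ` {..<N}"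
  proof
    fix z assume "z \<in> {z :: 'f. decode fe N e z \<noteq> None}"
    then have "the_inv_into {..<CARD('f)} fe z < N"
      by (auto simp: decode_def Let_def split: if_splits)
    moreover have "fe (the_inv_into {..<CARD('f)} fe z) = z"
      using fe by (simp add: bij_betw_def f_the_inv_into_f)
    ultimately show "z \<in> fe ` {..<N}" by (metis imageI lessThan_iff)
  qed
  then have "card {z :: 'f. decode fe N e z \<noteq> None} \<le> card (fe ` {..<N})"
    by (intro card_mono) auto
  also have "\<dots> \<le> N" using card_image_le[of "{..<N}" fe] by simp
  finally show ?thesis .
qed

lemma decode_mem:
  assumes "decode fe N e z = Some v" and "bij_betw e {..<N} C"
  shows "v \<in> C"
  using assms by (auto simp: decode_def Let_def bij_betw_def split: if_splits)

lemma card_bit_vec_le: "card (carrier_vec m :: bit vec set) \<le> 2 ^ m"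
proof -
  have UNIV_bit: "(UNIV :: bit set) = {0, 1}" by (auto intro: bit.exhaust)
  have "v \<in> (\<lambda>f. vec m f) ` ({..<m} \<rightarrow>\<^sub>E UNIV)" if "v \<in> carrier_vec m" for v :: "bit vec"
    using that by (intro image_eqI[of _ _ "restrict (\<lambda>i. v $ i) {..<m}"]) auto
  then have "(carrier_vec m :: bit vec set) \<subseteq> (\<lambda>f. vec m f) ` ({..<m} \<rightarrow>\<^sub>E UNIV)" by blast
  moreover have fin: "finite ({..<m} \<rightarrow>\<^sub>E (UNIV :: bit set))" by (intro finite_PiE) (auto simp: UNIV_bit)
  ultimately have "card (carrier_vec m :: bit vec set) \<le> card ({..<m} \<rightarrow>\<^sub>E (UNIV :: bit set))"
    by (meson card_image_le card_mono finite_imageI order_trans)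
  also have "\<dots> = 2 ^ m" by (simp add: card_PiE UNIV_bit numeral_2_eq_2)
  finally show ?thesis .
qed

lemma card_S1_le: "card (S1 n k) \<le> fact n * 2 ^ (n - k)"
proof -
  have "card {\<sigma>. \<sigma> permutes {..<n}} = fact n" by (rule card_permutations) auto
  then show ?thesis
    unfolding S1_def card_cartesian_product using card_bit_vec_le[of "n - k"] by simp
qed

lemma permute_vec_inv:
  assumes "\<sigma> permutes {..<n}" "dim_vec v = n"
  shows "permute_vec (inv_into UNIV \<sigma>) v = vec n (\<lambda>i. v $ \<sigma> i)"
  using assms by (simp add: permute_vec_def permutes_bij inv_inv_eq)

text \<open>\<open>\<sigma>\<close> maps the support of the permuted vector bijectively onto the
  support of \<open>v\<close>.\<close>

lemma hamming_weight_permute: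
  assumes \<sigma>: "\<sigma> permutes {..<n}" and v: "v \<in> carrier_vec n"
  shows "hamming_weight (vec n (\<lambda>i. v $ \<sigma> i)) = hamming_weight v"
proof -
  have "bij_betw \<sigma> {i. i < n \<and> v $ \<sigma> i \<noteq> 0} {i. i < n \<and> v $ i \<noteq> 0}"
  proof (rule bij_betw_imageI)
    show "inj_on \<sigma> {i. i < n \<and> v $ \<sigma> i \<noteq> 0}" using permutes_inj[OF \<sigma>] by (rule inj_on_subset) simp
    have "\<sigma> i < n \<longleftrightarrow> i < n" for i using permutes_in_image[OF \<sigma>, of i] by simp
    moreover have "\<exists>j. \<sigma> j = i" for i using permutes_surj[OF \<sigma>] by (metis surjD)
    ultimately show "\<sigma> ` {i. i < n \<and> v $ \<sigma> i \<noteq> 0} = {i. i < n \<and> v $ i \<noteq> 0}"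
      by (auto simp: image_iff) metis
  qed
  from bij_betw_same_card[OF this] show ?thesis
    using v by (simp add: hamming_weight_def cong: conj_cong)
qed

text \<open>The vector \<open>v2 + v3\<close>, with \<open>\<sigma>\<close> undone, keeps its weight
  \<open>w\<close> and has syndrome \<open>s' + (s + s')\<close>, which is \<open>s\<close> over the
  field with two elements.\<close>

lemma no_instance_contradiction:
  assumes no: "sd_no_instance n k w H s"
    and \<sigma>: "\<sigma> permutes {..<n}" and s': "s' \<in> carrier_vec (n - k)"
    and v: "v2 \<in> carrier_vec n" "v3 \<in> carrier_vec n"
    and weight: "hamming_weight (v2 + v3) = w"
    and H2: "H *\<^sub>v permute_vec (inv_into UNIV \<sigma>) v2 = s'"
    and H3: "H *\<^sub>v permute_vec (inv_into UNIV \<sigma>) v3 = s + s'"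
  shows False
proof -
  have H: "H \<in> carrier_mat (n - k) n" and s: "s \<in> carrier_vec (n - k)"
    using no by (auto simp: sd_no_instance_def sd_instance_def)
  have dist: "vec n (\<lambda>i. (v2 + v3) $ \<sigma> i) = vec n (\<lambda>i. v2 $ \<sigma> i) + vec n (\<lambda>i. v3 $ \<sigma> i)"
    using permutes_in_image[OF \<sigma>] v by (intro eq_vecI) auto
  have "H *\<^sub>v vec n (\<lambda>i. (v2 + v3) $ \<sigma> i) = s' + (s + s')"
    using H2 H3 v H unfolding dist
    by (subst mult_add_distrib_mat_vec[of _ "n - k" n]) (simp_all add: permute_vec_inv[OF \<sigma>])
  also have "\<dots> = s"
  proof (rule eq_vecI)
    fix i assume "i < dim_vec s"
    moreover have "a + (b + a) = b" for a b :: bit by (cases a; cases b) simp_all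
    ultimately show "(s' + (s + s')) $ i = s $ i" using s s' by simp
  qed (use s s' in simp)
  finally have "H *\<^sub>v vec n (\<lambda>i. (v2 + v3) $ \<sigma> i) = s" .
  moreover have "hamming_weight (vec n (\<lambda>i. (v2 + v3) $ \<sigma> i)) = w"
    using hamming_weight_permute[OF \<sigma>, of "v2 + v3"] v weight by simp
  ultimately show False using no by (auto simp: sd_no_instance_def)
qed

section \<open>Openings of commitments\<close>

text \<open>The value of \<open>b\<close> at which the two lines \<open>fst p + snd p * b\<close>
  and \<open>fst q + snd q * b\<close> meet.\<close>

definition key :: "'f::field \<times> 'f \<Rightarrow> 'f \<times> 'f \<Rightarrow> 'f" where
  "key p q = (fst q - fst p) / (snd p - snd q)"

text \<open>Equal slopes would force equal intercepts and hence \<open>p = q\<close>, so the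
  denominator is nonzero.\<close>

lemma key_eq:
  assumes "fst p + snd p * b = fst q + snd q * b" "p \<noteq> q"
  shows "b = key p q"
proof -
  have "snd p \<noteq> snd q" using assms by (auto simp: prod_eq_iff)
  moreover have "(snd p - snd q) * b = fst q - fst p" using assms(1) by (simp add: algebra_simps)
  ultimately show ?thesis unfolding key_def by (simp add: eq_divide_eq mult.commute)
qed

text \<open>Each position is opened in exactly two of the three challenges. If both openings agree
  at every position, the three answers decode to one common \<open>\<sigma>\<close>,
  \<open>s'\<close>, \<open>v2\<close>, \<open>v3\<close> that solves the instance; a disagreement
  gives away a coordinate of \<open>b\<close>.\<close>

lemma stern_wins_all:
  assumes no: "sd_no_instance n k w H s"
    and e1: "bij_betw e1 {..<card (S1 n k)} (S1 n k)" and e2: "bij_betw e2 {..<2 ^ n} (carrier_vec n)"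
    and win: "stern_wins n k w H s fe e1 e2 b 1 y p" "stern_wins n k w H s fe e1 e2 b 2 y q"
      "stern_wins n k w H s fe e1 e2 b 3 y r"
  shows "b 1 = key (q 1) (r 1) \<or> b 2 = key (p 2) (r 2) \<or> b 3 = key (p 3) (q 3)"
proof (rule ccontr)
  assume contr: "\<not> ?thesis"
  have sets: "{1,2,3} - {1} = {2, 3 :: nat}" "{1,2,3} - {2} = {1, 3 :: nat}" "{1,2,3} - {3} = {1, 2 :: nat}"
    by auto
  have y: "y 2 = fst (p 2) + snd (p 2) * b 2" "y 3 = fst (p 3) + snd (p 3) * b 3"
    "y 1 = fst (q 1) + snd (q 1) * b 1" "y 3 = fst (q 3) + snd (q 3) * b 3"
    "y 1 = fst (r 1) + snd (r 1) * b 1" "y 2 = fst (r 2) + snd (r 2) * b 2"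
    using win by (simp_all add: stern_wins_def Let_def sets del: One_nat_def insert_Diff_if)
  have eq: "q 1 = r 1" "p 2 = r 2" "p 3 = q 3"
    using contr y key_eq[of "q 1" "b 1" "r 1"] key_eq[of "p 2" "b 2" "r 2"] key_eq[of "p 3" "b 3" "q 3"]
    by auto
  obtain v2 v3 where 1: "decode fe (2 ^ n) e2 (snd (p 2)) = Some v2"
    "decode fe (2 ^ n) e2 (snd (p 3)) = Some v3" "hamming_weight (v2 + v3) = w"
    using win(1) by (auto simp: stern_wins_def Let_def simp del: One_nat_def)
  obtain \<sigma> s' where 2: "decode fe (card (S1 n k)) e1 (snd (q 1)) = Some (\<sigma>, s')"
    "H *\<^sub>v permute_vec (inv_into UNIV \<sigma>) v3 = s + s'"
    using win(2) 1 eq by (auto simp: stern_wins_def Let_def simp del: One_nat_def)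
  have 3: "H *\<^sub>v permute_vec (inv_into UNIV \<sigma>) v2 = s'"
    using win(3) 1 2 eq by (auto simp: stern_wins_def Let_def simp del: One_nat_def)
  have "\<sigma> permutes {..<n}" "s' \<in> carrier_vec (n - k)"
    using decode_mem[OF 2(1) e1] by (auto simp: S1_def)
  then show False
    using no_instance_contradiction[OF no _ _ decode_mem[OF 1(1) e2] decode_mem[OF 1(2) e2] 1(3) 3 2(2)]
    by blast
qed

text \<open>A union of three slices, each with one coordinate fixed and the other two free.\<close>

lemma card_keys_le:
  fixes \<beta> :: "nat \<Rightarrow> 'f::finite"
  shows "card {b \<in> {1,2,3::nat} \<rightarrow>\<^sub>E UNIV. b 1 = \<beta> 1 \<or> b 2 = \<beta> 2 \<or> b 3 = \<beta> 3} \<le> 3 * CARD('f) ^ 2"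
proof -
  let ?I = "{1,2,3} :: nat set"
  let ?C = "\<lambda>i. \<Pi>\<^sub>E j\<in>?I. if j = i then {\<beta> i} else UNIV"
  have C: "card (?C i) = CARD('f) ^ 2" if "i \<in> ?I" for i
    using that by (auto simp: card_PiE power2_eq_square)
  have fin: "finite (\<Union>i\<in>?I. ?C i)" by (auto intro!: finite_PiE)
  have "{b \<in> ?I \<rightarrow>\<^sub>E UNIV. b 1 = \<beta> 1 \<or> b 2 = \<beta> 2 \<or> b 3 = \<beta> 3} \<subseteq> (\<Union>i\<in>?I. ?C i)"
  proof
    fix b assume "b \<in> {b \<in> ?I \<rightarrow>\<^sub>E UNIV. b 1 = \<beta> 1 \<or> b 2 = \<beta> 2 \<or> b 3 = \<beta> 3}"
    then have "b \<in> ?I \<rightarrow>\<^sub>E UNIV" and "\<exists>i\<in>?I. b i = \<beta> i" by auto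
    then obtain i where "i \<in> ?I" "b i = \<beta> i" "b \<in> ?C i" by (fastforce simp: PiE_iff)
    then show "b \<in> (\<Union>i\<in>?I. ?C i)" by blast
  qed
  then have "card {b \<in> ?I \<rightarrow>\<^sub>E UNIV. b 1 = \<beta> 1 \<or> b 2 = \<beta> 2 \<or> b 3 = \<beta> 3} \<le> card (\<Union>i\<in>?I. ?C i)"
    by (rule card_mono[OF fin])
  also have "\<dots> \<le> (\<Sum>i\<in>?I. card (?C i))" by (intro card_UN_le) auto
  also have "\<dots> = (\<Sum>i\<in>?I. CARD('f) ^ 2)" by (intro sum.cong refl C)
  finally show ?thesis by simp
qed

text \<open>Once \<open>b\<close> and \<open>y\<close> are fixed, the commitment equation determines
  the first component of a pair from the second, so only the decodable second components are
  counted.\<close>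

lemma card_openings_le:
  fixes b y :: "nat \<Rightarrow> 'f::{field,finite}"
  assumes J: "finite J"
    and V: "\<And>az i. az \<in> V \<Longrightarrow> i \<in> J \<Longrightarrow> y i = fst (az i) + snd (az i) * b i \<and> snd (az i) \<in> D i"
    and D: "\<And>i. i \<in> J \<Longrightarrow> card (D i) \<le> N i"
    and ext: "V \<subseteq> J \<rightarrow>\<^sub>E UNIV"
  shows "card V \<le> (\<Prod>i\<in>J. N i)"
proof -
  let ?P = "\<Pi>\<^sub>E i\<in>J. (\<lambda>z. (y i - z * b i, z)) ` D i"
  have "V \<subseteq> ?P"
  proof
    fix az assume az: "az \<in> V"
    have "az i \<in> (\<lambda>z. (y i - z * b i, z)) ` D i" if "i \<in> J" for i
      using V[OF az that] by (auto intro!: image_eqI[of _ _ "snd (az i)"] simp: prod_eq_iff)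
    then show "az \<in> ?P" using az ext by (auto simp: PiE_iff)
  qed
  then have "card V \<le> card ?P" using J by (intro card_mono finite_PiE) auto
  also have "\<dots> \<le> (\<Prod>i\<in>J. N i)"
    unfolding card_PiE[OF J] using D by (intro prod_mono) (meson card_image_le finite le0 order_trans)
  finally show ?thesis .
qed

section \<open>Existence of a strategy\<close>

lemma povm_trivial:
  assumes "finite S" "a0 \<in> S"
  shows "povm 1 S (\<lambda>a. if a = a0 then 1\<^sub>m 1 else 0\<^sub>m 1 1)"
proof -
  have "psd_mat 1 (0\<^sub>m 1 1)"
    by (auto simp: psd_mat_def cscalar_mult_mat_vec[of _ 1] simp del: One_nat_def)
  moreover have "msum 1 S (\<lambda>a. if a = a0 then 1\<^sub>m 1 else 0\<^sub>m 1 1) = 1\<^sub>m 1"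
  proof (rule eq_matI)
    fix i j assume ij: "i < dim_row (1\<^sub>m 1)" "j < dim_col (1\<^sub>m 1)"
    have "(\<Sum>a\<in>S. (if a = a0 then 1\<^sub>m 1 else 0\<^sub>m 1 1 :: complex mat) $$ (0, 0)) = (\<Sum>a\<in>S. if a = a0 then 1 else 0)"
      by (intro sum.cong) auto
    then show "msum 1 S (\<lambda>a. if a = a0 then 1\<^sub>m 1 else 0\<^sub>m 1 1) $$ (i, j) = 1\<^sub>m 1 $$ (i, j)"
      using assms ij by (simp add: msum_def)
  qed (simp_all add: msum_def)
  ultimately show ?thesis by (simp add: povm_msum psd_mat_one)
qed

text \<open>Bounding the supremum requires a nonempty set of values; constant answers on a
  one-dimensional state provide one.\<close>

lemma quantum_strategy_exists:
  assumes A: "\<And>x. x \<in> quA G \<Longrightarrow> finite (ansA G x) \<and> ansA G x \<noteq> {}"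
    and B: "\<And>y. y \<in> quB G \<Longrightarrow> finite (ansB G y) \<and> ansB G y \<noteq> {}"
  shows "\<exists>dA dB \<rho> A B. quantum_strategy G dA dB \<rho> A B"
proof -
  let ?T = "\<lambda>S a. if a = (SOME a. a \<in> S) then 1\<^sub>m 1 else 0\<^sub>m 1 1 :: complex mat"
  have density: "density_mat (1 * 1) (1\<^sub>m 1)"
    using psd_mat_one[of 1] by (simp add: density_mat_def mat_trace_def)
  have povm: "povm 1 S (?T S)" if "finite S \<and> S \<noteq> {}" for S :: "'e set"
    using that by (intro povm_trivial) (auto intro: some_in_eq[THEN iffD2])
  have "quantum_strategy G 1 1 (1\<^sub>m 1) (\<lambda>x. ?T (ansA G x)) (\<lambda>y. ?T (ansB G y))"
    unfolding quantum_strategy_def by (intro conjI ballI density povm A B)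
  then show ?thesis by (intro exI)
qed

section \<open>The winning probability\<close>

text \<open>The choice \<open>l = 2 * r\<close> with \<open>r ^ 4 = C / Q\<close> makes both error
  terms multiples of \<open>r * Q ^ 3\<close>, namely \<open>3 / 2\<close> and at most
  \<open>3 / 8\<close>. Dividing their sum by \<open>3 * Q ^ 3\<close> leaves
  \<open>5 / 8 * r\<close>.\<close>

lemma optimised_bound:
  fixes Q K C :: real
  assumes Q: "0 < Q" and K: "K \<le> C" "0 < C" and r: "r = (C / Q) powr (1 / 4)"
  shows "((2 + 3 / 4 * (2 * r)) * Q ^ 3 + K * (3 * Q\<^sup>2) / (2 * r) ^ 3) / (3 * Q ^ 3) \<le> 2 / 3 + r"
proof -
  have r0: "0 < r" using Q K by (simp add: r)
  have "r ^ 4 = C / Q"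
    using Q K unfolding r by (simp add: powr_realpow[symmetric] powr_powr)
  then have C: "C = r ^ 4 * Q" using Q by simp
  have "K * (3 * Q\<^sup>2) / (2 * r) ^ 3 \<le> C * (3 * Q\<^sup>2) / (2 * r) ^ 3"
    using K r0 by (intro divide_right_mono mult_right_mono) auto
  also have "\<dots> = 3 / 8 * r * Q ^ 3"
    using r0 by (simp add: C power_mult_distrib power4_eq_xxxx power3_eq_cube power2_eq_square)
  finally have "(2 + 3 / 4 * (2 * r)) * Q ^ 3 + K * (3 * Q\<^sup>2) / (2 * r) ^ 3
      \<le> (2 + 15 / 8 * r) * Q ^ 3"
    by (simp add: algebra_simps)
  then have "((2 + 3 / 4 * (2 * r)) * Q ^ 3 + K * (3 * Q\<^sup>2) / (2 * r) ^ 3) / (3 * Q ^ 3)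
      \<le> (2 + 15 / 8 * r) * Q ^ 3 / (3 * Q ^ 3)"
    using Q by (intro divide_right_mono) auto
  also have "\<dots> = 2 / 3 + 5 / 8 * r" using Q by (simp add: field_simps)
  finally show ?thesis using r0 by simp
qed

lemma stern_win_prob_le:
  fixes fe :: "nat \<Rightarrow> 'f::{field,finite}"
  assumes fe: "bij_betw fe {..<CARD('f)} UNIV"
    and e1: "bij_betw e1 {..<card (S1 n k)} (S1 n k)"
    and e2: "bij_betw e2 {..<2 ^ n} (carrier_vec n)"
    and no: "sd_no_instance n k w H s"
    and strategy: "quantum_strategy (stern_game n k w H s fe e1 e2) dA dB \<rho> A B"
  shows "win_prob (stern_game n k w H s fe e1 e2) \<rho> A B
    \<le> 2 / 3 + (fact n * 2 ^ (4 * n) / real CARD('f)) powr (1 / 4)"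
proof -
  let ?Q = "CARD('f)" and ?I = "{1,2,3} :: nat set"
  define X :: "(nat \<Rightarrow> 'f) set" where "X = ?I \<rightarrow>\<^sub>E UNIV"
  define R :: "nat \<Rightarrow> (nat \<Rightarrow> 'f \<times> 'f) set" where "R c = (?I - {c}) \<rightarrow>\<^sub>E UNIV" for c
  define V where "V c b y = {az \<in> R c. stern_wins n k w H s fe e1 e2 b c y az}" for c b y
  let ?f = "\<lambda>b y c az. Re (mat_trace (\<rho> * kron (A b y) (B c az)))"
  \<comment> \<open>Challenge 1 opens two vectors, challenge 2 an element of \<open>S1\<close> and a
    vector; the third challenge contributes no factor.\<close>
  let ?K1 = "2 ^ n * 2 ^ n :: nat" and ?K2 = "card (S1 n k) * 2 ^ n"
  let ?C = "fact n * 2 ^ (4 * n) :: real"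
  define r where "r = (?C / real ?Q) powr (1 / 4)"
  have Q0: "0 < ?Q" by (simp add: card_gt_0_iff)
  have r0: "0 < r" unfolding r_def using Q0 by simp
  have finX: "finite X" unfolding X_def by (intro finite_PiE) auto
  have finR: "finite (R c)" for c unfolding R_def by (intro finite_PiE) auto
  have cardX: "card X = ?Q ^ 3" by (simp add: X_def card_PiE power3_eq_cube)
  have density: "density_mat (dA * dB) \<rho>"
    and Apovm: "b \<in> X \<Longrightarrow> povm dA X (A b)"
    and Bpovm: "c \<in> ?I \<Longrightarrow> povm dB (R c) (B c)" for b c
    using strategy by (auto simp: quantum_strategy_def stern_game_def X_def R_def)
  have sets: "?I - {1} = {2, 3}" "?I - {2} = {1, 3}" "?I - {3} = {1, 2}" by auto
  have VR: "V c b y \<subseteq> R c" for c b y by (auto simp: V_def)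
  let ?D1 = "{z. decode fe (card (S1 n k)) e1 z \<noteq> None}" and ?D2 = "{z. decode fe (2 ^ n) e2 z \<noteq> None}"
  note D = card_decodable_le[OF fe]
  have K1: "card (V 1 b y) \<le> ?K1" for b y
  proof -
    have "card (V 1 b y) \<le> (\<Prod>i\<in>{2, 3::nat}. 2 ^ n)"
    proof (rule card_openings_le)
      show "V 1 b y \<subseteq> {2, 3} \<rightarrow>\<^sub>E UNIV" using VR[of 1 b y] by (simp add: R_def sets del: One_nat_def)
      fix az :: "nat \<Rightarrow> 'f \<times> 'f" and i :: nat assume "az \<in> V 1 b y" "i \<in> {2, 3}"
      then show "y i = fst (az i) + snd (az i) * b i \<and> snd (az i) \<in> ?D2"
        by (auto simp: V_def stern_wins_def Let_def)
    qed (use D in auto)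
    then show ?thesis by simp
  qed
  have K2: "card (V 2 b y) \<le> ?K2" for b y
  proof -
    have "card (V 2 b y) \<le> (\<Prod>i\<in>{1, 3::nat}. if i = 1 then card (S1 n k) else 2 ^ n)"
    proof (rule card_openings_le)
      show "V 2 b y \<subseteq> {1, 3} \<rightarrow>\<^sub>E UNIV" using VR[of 2 b y] by (simp add: R_def sets del: One_nat_def)
      fix az :: "nat \<Rightarrow> 'f \<times> 'f" and i :: nat assume az: "az \<in> V 2 b y" and i: "i \<in> {1, 3}"
      then have "y i = fst (az i) + snd (az i) * b i"
        by (auto simp: V_def stern_wins_def Let_def)
      moreover have "snd (az 1) \<in> ?D1" "snd (az 3) \<in> ?D2"
        using az by (auto simp: V_def stern_wins_def Let_def)
      ultimately show "y i = fst (az i) + snd (az i) * b i \<and> snd (az i) \<in> (if i = 1 then ?D1 else ?D2)"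
        using i by auto
    next
      fix i :: nat
      show "card (if i = 1 then ?D1 else ?D2) \<le> (if i = 1 then card (S1 n k) else 2 ^ n)"
        by (cases "i = 1") (simp_all only: refl if_True if_False D)
    qed auto
    then show ?thesis by simp
  qed
  have guess: "card {b \<in> X. \<exists>y\<in>X. p \<in> V 1 b y \<and> q \<in> V 2 b y \<and> t \<in> V 3 b y} \<le> 3 * ?Q ^ 2" for p q t
  proof -
    \<comment> \<open>The candidate for each coordinate is computed from Bob's answers
      \<open>p\<close>, \<open>q\<close>, \<open>t\<close> to the challenges 1, 2, 3 alone,
      independently of \<open>b\<close> and \<open>y\<close>.\<close>
    define \<beta> where "\<beta> i = (if i = 1 then key (q 1) (t 1) else if i = 2 then key (p 2) (t 2) else key (p 3) (q 3))"
      for i :: nat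
    have "{b \<in> X. \<exists>y\<in>X. p \<in> V 1 b y \<and> q \<in> V 2 b y \<and> t \<in> V 3 b y}
        \<subseteq> {b \<in> ?I \<rightarrow>\<^sub>E UNIV. b 1 = \<beta> 1 \<or> b 2 = \<beta> 2 \<or> b 3 = \<beta> 3}"
    proof
      fix b assume "b \<in> {b \<in> X. \<exists>y\<in>X. p \<in> V 1 b y \<and> q \<in> V 2 b y \<and> t \<in> V 3 b y}"
      then obtain y where b: "b \<in> X" and "p \<in> V 1 b y" "q \<in> V 2 b y" "t \<in> V 3 b y" by blast
      then have "b 1 = key (q 1) (t 1) \<or> b 2 = key (p 2) (t 2) \<or> b 3 = key (p 3) (q 3)"
        unfolding V_def by (intro stern_wins_all[OF no e1 e2]) auto
      then show "b \<in> {b \<in> ?I \<rightarrow>\<^sub>E UNIV. b 1 = \<beta> 1 \<or> b 2 = \<beta> 2 \<or> b 3 = \<beta> 3}"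
        using b by (simp add: \<beta>_def X_def)
    qed
    then have "card {b \<in> X. \<exists>y\<in>X. p \<in> V 1 b y \<and> q \<in> V 2 b y \<and> t \<in> V 3 b y}
        \<le> card {b \<in> ?I \<rightarrow>\<^sub>E UNIV. b 1 = \<beta> 1 \<or> b 2 = \<beta> 2 \<or> b 3 = \<beta> 3}"
      by (intro card_mono) (auto intro!: finite_subset[OF _ finX] simp: X_def)
    also have "\<dots> \<le> 3 * ?Q ^ 2" by (rule card_keys_le)
    finally show ?thesis .
  qed
  \<comment> \<open>\<open>S1\<close> has at most \<open>n! 2^(n-k)\<close> elements, and the three
    vectors contribute \<open>2^n\<close> each.\<close>
  have K: "real (?K1 * ?K2) \<le> ?C"
  proof -
    have "?K1 * ?K2 \<le> 2 ^ n * 2 ^ n * ((fact n * 2 ^ n) * 2 ^ n)"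
      using card_S1_le[of n k] power_increasing[of "n - k" n "2::nat"]
      by (intro mult_le_mono order_refl) (auto intro: order_trans mult_le_mono2)
    also have "\<dots> = fact n * 2 ^ (4 * n)" by (simp add: power_mult power4_eq_xxxx power_mult_distrib[symmetric])
    finally have "real (?K1 * ?K2) \<le> real (fact n * 2 ^ (4 * n))" by (rule of_nat_mono)
    then show ?thesis by simp
  qed
  have "win_prob (stern_game n k w H s fe e1 e2) \<rho> A B
      = (\<Sum>b\<in>X. \<Sum>c\<in>?I. \<Sum>y\<in>X. \<Sum>az\<in>V c b y. ?f b y c az) / (3 * real ?Q ^ 3)"
  proof -
    have "(\<Sum>az\<in>R c. if stern_wins n k w H s fe e1 e2 b c y az then ?f b y c az else 0)
        = (\<Sum>az\<in>V c b y. ?f b y c az)" for b c y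
      unfolding V_def by (rule sum.inter_filter[OF finR, symmetric])
    note wins = this
    have "card ?I = 3" by simp
    then show ?thesis
      unfolding win_prob_def stern_game_def game.select_convs X_def[symmetric] R_def[symmetric] wins cardX
      by (simp only: of_nat_power of_nat_numeral mult.commute)
  qed
  \<comment> \<open>The challenges are independent of Alice's question and answer, so all three are
    grouped under one pair \<open>b\<close>, \<open>y\<close> and meet the same steered
    state.\<close>
  also have "(\<Sum>b\<in>X. \<Sum>c\<in>?I. \<Sum>y\<in>X. \<Sum>az\<in>V c b y. ?f b y c az)
      = (\<Sum>b\<in>X. \<Sum>y\<in>X. (\<Sum>az\<in>V 1 b y. ?f b y 1 az) + (\<Sum>az\<in>V 2 b y. ?f b y 2 az)
          + (\<Sum>az\<in>V 3 b y. ?f b y 3 az))"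
    by (simp add: sum.distrib add.assoc)
  also have "\<dots> / (3 * real ?Q ^ 3) \<le> ((2 + 3 / 4 * (2 * r)) * real (card X)
      + real ?K1 * real ?K2 * real (3 * ?Q ^ 2) / (2 * r) ^ 3) / (3 * real ?Q ^ 3)"
  proof (intro divide_right_mono)
    show "(\<Sum>b\<in>X. \<Sum>y\<in>X. (\<Sum>az\<in>V 1 b y. ?f b y 1 az) + (\<Sum>az\<in>V 2 b y. ?f b y 2 az)
          + (\<Sum>az\<in>V 3 b y. ?f b y 3 az))
        \<le> (2 + 3 / 4 * (2 * r)) * real (card X) + real ?K1 * real ?K2 * real (3 * ?Q ^ 2) / (2 * r) ^ 3"
      using r0
      by (intro three_challenge_bound[OF density Apovm finX Bpovm Bpovm Bpovm finR finR finR VR VR VR K1 K2 guess])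
        auto
  qed simp
  also have "\<dots> = ((2 + 3 / 4 * (2 * r)) * real ?Q ^ 3
      + real (?K1 * ?K2) * (3 * (real ?Q)\<^sup>2) / (2 * r) ^ 3) / (3 * real ?Q ^ 3)"
    by (simp add: cardX)
  also have "\<dots> \<le> 2 / 3 + r"
    using Q0 by (intro optimised_bound[OF _ K _ r_def]) auto
  finally show ?thesis unfolding r_def .
qed

theorem theorem3:
  fixes n k w Q :: nat
    and H :: "bit mat" and s :: "bit vec"
    and fe :: "nat \<Rightarrow> 'f::{field,finite}"
    and e1 :: "nat \<Rightarrow> (nat \<Rightarrow> nat) \<times> bit vec"
    and e2 :: "nat \<Rightarrow> bit vec"
  assumes "k \<le> n"
    and "CARD('f) = Q"
    and "card (S1 n k) \<le> Q" and "2 ^ n \<le> Q"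
    and "bij_betw fe {..<Q} UNIV"
    and "bij_betw e1 {..<card (S1 n k)} (S1 n k)"
    and "bij_betw e2 {..<2 ^ n} (carrier_vec n)"
    and "sd_no_instance n k w H s"
  shows "entangled_value (stern_game n k w H s fe e1 e2)
           \<le> 2 / 3 + (fact n * 2 ^ (4 * n) / real Q) powr (1 / 4)"
  unfolding entangled_value_def
proof (rule cSup_least)
  let ?G = "stern_game n k w H s fe e1 e2"
  have "\<exists>dA dB \<rho> A B. quantum_strategy ?G dA dB \<rho> A B"
    by (intro quantum_strategy_exists) (auto simp: stern_game_def PiE_eq_empty_iff intro!: finite_PiE)
  then show "{win_prob ?G \<rho> A B | dA dB \<rho> A B. quantum_strategy ?G dA dB \<rho> A B} \<noteq> {}" by blast
next
  fix p assume "p \<in> {win_prob (stern_game n k w H s fe e1 e2) \<rho> A B | dA dB \<rho> A B.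
      quantum_strategy (stern_game n k w H s fe e1 e2) dA dB \<rho> A B}"
  then show "p \<le> 2 / 3 + (fact n * 2 ^ (4 * n) / real Q) powr (1 / 4)"
    using stern_win_prob_le[OF _ assms(6-8)] assms(2,5) by blast
qed

end
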